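(* Let $A$ be a prime $C^*$-algebra. Every derivation $\delta \in \mathrm{Der}(A) \cap \operatorname{Im}\theta_A$ is inner in $A$ (i.e. there is $a\in A$ with $\delta(x)=ax-xa$ for all $x\in A$). If $A$ is not unital, then $\mathrm{Der}(A) \cap \operatorname{Im}\theta_A=\{0\}$.
   Context: A $C^*$-algebra $A$ is prime if the zero ideal $(0)$ is a prime ideal of $A$. "Ideal" means closed two-sided ideal. A derivation on $A$ is a linear map $\delta:A\to A$ with $\delta(ab)=\delta(a)b+a\delta(b)$ for all $a,b\in A$; $\mathrm{Der}(A)$ is the set of all derivations on $A$. $A\otimes_h A$ is the Haagerup tensor product of $A$ with itself, i.e. the completion of the algebraic tensor product $A\otimes A$ in the norm $\|t\|_h=\inf\{\|\sum_k a_ka_k^*\|^{1/2}\|\sum_k b_k^*b_k\|^{1/2} : t=\sum_k a_k\otimes b_k\}$. $\mathrm{ICB}(A)$ is the space, with the cb-norm, of all completely bounded maps $T:A\to A$ with $T(J)\subseteq J$ for every ideal $J$ of $A$. $\theta_A: A\otimes_h A\to \mathrm{ICB}(A)$ is the canonical (linear) contraction determined by $\theta_A(a\otimes b)(x)=axb$ for $a,b,x\in A$, and $\operatorname{Im}\theta_A$ is its image. *)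

theory Defs
  imports "HOL-Analysis.Analysis"
begin

section \<open>C*-algebras, ideals, derivations\<close>

text \<open>Not necessarily unital. The class \<open>real_normed_algebra\<close> has no unit; \<open>scaleC\<close> is the
  complex scalar multiplication, which extends the real one of that class.\<close>

class cstar_algebra = banach + real_normed_algebra +
  fixes scaleC :: "complex \<Rightarrow> 'a \<Rightarrow> 'a" (infixr "*\<^sub>C" 75)
    and adj :: "'a \<Rightarrow> 'a"
  assumes scaleC_add_right: "c *\<^sub>C (x + y) = c *\<^sub>C x + c *\<^sub>C y"
    and scaleC_add_left: "(c + d) *\<^sub>C x = c *\<^sub>C x + d *\<^sub>C x"
    and scaleC_scaleC: "c *\<^sub>C d *\<^sub>C x = (c * d) *\<^sub>C x"
    and scaleR_scaleC: "r *\<^sub>R x = complex_of_real r *\<^sub>C x"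
    and mult_scaleC_left: "(c *\<^sub>C x) * y = c *\<^sub>C (x * y)"
    and mult_scaleC_right: "x * (c *\<^sub>C y) = c *\<^sub>C (x * y)"
    and norm_scaleC: "norm (c *\<^sub>C x) = cmod c * norm x"
    and adj_adj: "adj (adj x) = x"
    and adj_add: "adj (x + y) = adj x + adj y"
    and adj_scaleC: "adj (c *\<^sub>C x) = cnj c *\<^sub>C adj x"
    and adj_mult: "adj (x * y) = adj y * adj x"
    and cstar_identity: "norm (adj x * x) = (norm x)\<^sup>2"

definition cstar_ideal :: "'a::cstar_algebra set \<Rightarrow> bool" where
  "cstar_ideal J \<longleftrightarrow> closed J \<and> 0 \<in> J \<and> (\<forall>x\<in>J. \<forall>y\<in>J. x + y \<in> J) \<and>
     (\<forall>c. \<forall>x\<in>J. c *\<^sub>C x \<in> J) \<and> (\<forall>a. \<forall>x\<in>J. a * x \<in> J \<and> x * a \<in> J)"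

definition prime_cstar_ideal :: "'a::cstar_algebra set \<Rightarrow> bool" where
  "prime_cstar_ideal P \<longleftrightarrow> cstar_ideal P \<and> P \<noteq> UNIV \<and>
     (\<forall>I J. cstar_ideal I \<longrightarrow> cstar_ideal J \<longrightarrow> (\<forall>x\<in>I. \<forall>y\<in>J. x * y \<in> P) \<longrightarrow> I \<subseteq> P \<or> J \<subseteq> P)"

definition complex_linear :: "('a::cstar_algebra \<Rightarrow> 'a) \<Rightarrow> bool" where
  "complex_linear T \<longleftrightarrow> (\<forall>x y. T (x + y) = T x + T y) \<and> (\<forall>c x. T (c *\<^sub>C x) = c *\<^sub>C T x)"

definition Der :: "('a::cstar_algebra \<Rightarrow> 'a) set" where
  "Der = {\<delta>. complex_linear \<delta> \<and> (\<forall>a b. \<delta> (a * b) = \<delta> a * b + a * \<delta> b)}"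


section \<open>Completely bounded maps\<close>

text \<open>An \<open>n\<close> by \<open>n\<close> matrix over \<open>A\<close> is a function \<open>nat \<Rightarrow> nat \<Rightarrow> 'a\<close> of which only the entries
  with indices below \<open>n\<close> are used; similarly for columns in \<open>A\<^sup>n\<close>.

  The *-algebra \<open>M\<^sub>n(A)\<close> acts faithfully by left multiplication, through adjointable operators, on
  the Hilbert C*-module \<open>A\<^sup>n\<close> with inner product \<open>\<Sum>i. v\<^sub>i\<^sup>* w\<^sub>i\<close>. The operator norm of this action
  is therefore the (unique) C*-norm of \<open>M\<^sub>n(A)\<close>.\<close>

definition column_norm :: "nat \<Rightarrow> (nat \<Rightarrow> 'a::cstar_algebra) \<Rightarrow> real" where
  "column_norm n v = sqrt (norm (\<Sum>i<n. adj (v i) * v i))"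

definition matrix_norm :: "nat \<Rightarrow> (nat \<Rightarrow> nat \<Rightarrow> 'a::cstar_algebra) \<Rightarrow> real" where
  "matrix_norm n X = Sup {column_norm n (\<lambda>i. \<Sum>j<n. X i j * v j) | v. column_norm n v \<le> 1}"

definition amplification :: "('a \<Rightarrow> 'a) \<Rightarrow> (nat \<Rightarrow> nat \<Rightarrow> 'a) \<Rightarrow> nat \<Rightarrow> nat \<Rightarrow> 'a" where
  "amplification T X = (\<lambda>i j. T (X i j))"

definition completely_bounded :: "('a::cstar_algebra \<Rightarrow> 'a) \<Rightarrow> bool" where
  "completely_bounded T \<longleftrightarrow> complex_linear T \<and>
     (\<exists>C. \<forall>n X. matrix_norm n (amplification T X) \<le> C * matrix_norm n X)"

definition cb_norm :: "('a::cstar_algebra \<Rightarrow> 'a) \<Rightarrow> real" where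
  "cb_norm T = Sup {matrix_norm n (amplification T X) | n X. matrix_norm n X \<le> 1}"

definition ICB :: "('a::cstar_algebra \<Rightarrow> 'a) set" where
  "ICB = {T. completely_bounded T \<and> (\<forall>J. cstar_ideal J \<longrightarrow> T ` J \<subseteq> J)}"


section \<open>The algebraic tensor product\<close>

text \<open>The list \<open>[(a\<^sub>1, b\<^sub>1), \<dots>, (a\<^sub>n, b\<^sub>n)]\<close> stands for the formal sum of the \<open>a\<^sub>k \<otimes> b\<^sub>k\<close>, and two
  formal sums are identified if the defining relations of the tensor product over the complex
  numbers make them equal. (The commutative monoid so presented is a group, as \<open>(-a) \<otimes> b\<close> is
  inverse to \<open>a \<otimes> b\<close>.)\<close>

inductive tensor_eq :: "('a::cstar_algebra \<times> 'a) list \<Rightarrow> ('a \<times> 'a) list \<Rightarrow> bool" where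
  refl: "tensor_eq s s"
| sym: "tensor_eq s t \<Longrightarrow> tensor_eq t s"
| trans: "tensor_eq s t \<Longrightarrow> tensor_eq t u \<Longrightarrow> tensor_eq s u"
| append: "tensor_eq s s' \<Longrightarrow> tensor_eq t t' \<Longrightarrow> tensor_eq (s @ t) (s' @ t')"
| commute: "tensor_eq (s @ t) (t @ s)"
| add_left: "tensor_eq [(a + a', b)] [(a, b), (a', b)]"
| add_right: "tensor_eq [(a, b + b')] [(a, b), (a, b')]"
| scale: "tensor_eq [(c *\<^sub>C a, b)] [(a, c *\<^sub>C b)]"
| zero: "tensor_eq [(0, b)] []"

quotient_type (overloaded) 'a tensor = "('a::cstar_algebra \<times> 'a) list" / tensor_eq
  morphisms rep_tensor tensor_of
  by (rule equivpI) (auto intro!: reflpI sympI transpI intro: tensor_eq.intros)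

lemma tensor_eq_uminus:
  "tensor_eq s t \<Longrightarrow> tensor_eq (map (\<lambda>(a, b). (- a, b)) s) (map (\<lambda>(a, b). (- a, b)) t)"
proof (induction rule: tensor_eq.induct)
  case (add_left a a' b)
  show ?case using tensor_eq.add_left[of "- a" "- a'" b] by simp
next
  case (scale c a b)
  have "c *\<^sub>C (- a) + c *\<^sub>C a = c *\<^sub>C (- a + a)" by (simp only: scaleC_add_right)
  also have "\<dots> = 0" using scaleC_add_right[of c 0 "0 :: 'a"] by simp
  finally have "c *\<^sub>C (- a) = - (c *\<^sub>C a)" by (rule eq_neg_iff_add_eq_0[THEN iffD2])
  then show ?case using tensor_eq.scale[of c "- a" b] by simp
qed (auto intro: tensor_eq.intros)

lemma tensor_eq_left_inverse: "tensor_eq (map (\<lambda>(a, b). (- a, b)) s @ s) []"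
proof (induction s)
  case (Cons p s)
  obtain a b where p: "p = (a, b)" by (cases p)
  let ?m = "map (\<lambda>(a, b). (- a, b)) s"
  have "tensor_eq [(- a, b), (a, b)] [(- a + a, b)]"
    by (rule tensor_eq.sym, rule tensor_eq.add_left)
  then have cancel: "tensor_eq [(- a, b), (a, b)] []"
    using tensor_eq.zero[of b] by (auto intro: tensor_eq.trans)
  have "tensor_eq ([(- a, b)] @ (?m @ ([(a, b)] @ s))) ([(- a, b)] @ (([(a, b)] @ s) @ ?m))"
    by (intro tensor_eq.append tensor_eq.refl tensor_eq.commute)
  moreover have "tensor_eq ([(- a, b), (a, b)] @ (s @ ?m)) ([] @ (?m @ s))"
    by (intro tensor_eq.append cancel tensor_eq.commute)
  ultimately show ?case
    using Cons.IH p by (auto intro: tensor_eq.trans)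
qed (simp add: tensor_eq.refl)

instantiation tensor :: (cstar_algebra) ab_group_add
begin

lift_definition zero_tensor :: "'a tensor" is "[]" .

lift_definition plus_tensor :: "'a tensor \<Rightarrow> 'a tensor \<Rightarrow> 'a tensor" is "(@)"
  by (rule tensor_eq.append)

lift_definition uminus_tensor :: "'a tensor \<Rightarrow> 'a tensor" is "map (\<lambda>(a, b). (- a, b))"
  by (rule tensor_eq_uminus)

definition minus_tensor :: "'a tensor \<Rightarrow> 'a tensor \<Rightarrow> 'a tensor" where
  "minus_tensor s t = s + - t"

instance
proof
  fix s t u :: "'a tensor"
  show "s + t + u = s + (t + u)" by transfer (simp add: tensor_eq.refl)
  show "s + t = t + s" by transfer (rule tensor_eq.commute)
  show "0 + s = s" by transfer (simp add: tensor_eq.refl)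
  show "- s + s = 0" by transfer (rule tensor_eq_left_inverse)
  show "s - t = s + - t" by (rule minus_tensor_def)
qed

end


section \<open>The Haagerup tensor product and the canonical contraction\<close>

definition haagerup_norm :: "'a::cstar_algebra tensor \<Rightarrow> real" where
  "haagerup_norm t = Inf {sqrt (norm (\<Sum>(a, b)\<leftarrow>l. a * adj a)) * sqrt (norm (\<Sum>(a, b)\<leftarrow>l. adj b * b))
     | l. tensor_of l = t}"

definition haagerup_Cauchy :: "(nat \<Rightarrow> 'a::cstar_algebra tensor) \<Rightarrow> bool" where
  "haagerup_Cauchy s \<longleftrightarrow> (\<forall>e>0. \<exists>N. \<forall>m\<ge>N. \<forall>n\<ge>N. haagerup_norm (s m - s n) < e)"

definition haagerup_null_rel ::
  "((nat \<Rightarrow> 'a::cstar_algebra tensor) \<times> (nat \<Rightarrow> 'a tensor)) set" where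
  "haagerup_null_rel = {(s, t). haagerup_Cauchy s \<and> haagerup_Cauchy t \<and>
     (\<lambda>n. haagerup_norm (s n - t n)) \<longlonglongrightarrow> 0}"

text \<open>The completion of the algebraic tensor product: Cauchy sequences modulo null sequences.\<close>

definition haagerup_tensor_product :: "(nat \<Rightarrow> 'a::cstar_algebra tensor) set set" where
  "haagerup_tensor_product = Collect haagerup_Cauchy // haagerup_null_rel"

lift_definition theta_alg :: "'a::cstar_algebra tensor \<Rightarrow> 'a \<Rightarrow> 'a"
  is "\<lambda>l x. \<Sum>(a, b)\<leftarrow>l. a * x * b"
proof -
  fix s t :: "('a \<times> 'a) list"
  assume "tensor_eq s t"
  then show "(\<lambda>x. \<Sum>(a, b)\<leftarrow>s. a * x * b) = (\<lambda>x. \<Sum>(a, b)\<leftarrow>t. a * x * b)"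
  proof (induction rule: tensor_eq.induct)
    case (append s s' t t')
    then show ?case by (simp add: fun_eq_iff)
  qed (auto simp: algebra_simps mult_scaleC_left mult_scaleC_right)
qed

text \<open>The map \<open>\<theta>\<^sub>A\<close> is the extension by continuity of \<open>theta_alg\<close>, a contraction from the Haagerup
  norm to the cb-norm: it sends the class \<open>\<xi>\<close> of a Cauchy sequence \<open>s\<close> to the cb-norm limit \<open>T\<close>
  of the maps \<open>theta_alg (s n)\<close> in \<open>ICB\<close>, which does not depend on the choice of \<open>s\<close> in \<open>\<xi>\<close>.
  The following predicate is the graph of \<open>\<theta>\<^sub>A\<close>.\<close>

definition theta_graph ::
  "(nat \<Rightarrow> 'a::cstar_algebra tensor) set \<Rightarrow> ('a \<Rightarrow> 'a) \<Rightarrow> bool" where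
  "theta_graph \<xi> T \<longleftrightarrow> \<xi> \<in> haagerup_tensor_product \<and> T \<in> ICB \<and>
     (\<exists>s\<in>\<xi>. (\<lambda>n. cb_norm (\<lambda>x. theta_alg (s n) x - T x)) \<longlonglongrightarrow> 0)"

definition Im_theta :: "('a::cstar_algebra \<Rightarrow> 'a) set" where
  "Im_theta = {T. \<exists>\<xi>. theta_graph \<xi> T}"

end

theory Submission
  imports Defs
begin

text \<open>A derivation \<open>\<delta>\<close> in the image of \<open>\<theta>\<^sub>A\<close> is a limit, in operator norm, of elementary operators
  \<open>E\<^sub>n x = \<Sum> a\<^sub>k x b\<^sub>k\<close>, and the Leibniz rule makes \<open>\<Sum> a\<^sub>k x (y b\<^sub>k - b\<^sub>k y)\<close> close to \<open>x \<delta>(y)\<close>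
  uniformly in \<open>x\<close>. Let \<open>\<phi>\<close> be a functional excised in the sense that every finite set of elements \<open>a\<close>
  has elements \<open>y\<close> of norm \<open>1\<close> with \<open>y\<^sup>* a y \<approx> \<phi>(a) y\<^sup>* y\<close>. Replacing \<open>x\<close> by \<open>y x\<close> and multiplying by
  \<open>y\<^sup>*\<close> on the left turns each \<open>a\<^sub>k\<close> into \<open>\<phi>(a\<^sub>k)\<close>. Since \<open>sup \<parallel>u x v\<parallel> = \<parallel>u\<parallel> \<parallel>v\<parallel>\<close> over the unit ball of a
  prime C*-algebra, the elements \<open>\<Sum> \<phi>(a\<^sub>k) b\<^sub>k\<close> form a Cauchy sequence and \<open>\<delta>\<close> is the commutator with its
  limit. Excised functionals always exist, and in a nonunital algebra \<open>\<phi> = 0\<close> is one, so that the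
  limit is then \<open>0\<close>.\<close>

section \<open>Involution and complex scalars\<close>

text \<open>The obstacle is that only the operators \<open>E\<^sub>n\<close> are under control, in
  operator norm, whereas the slices \<open>\<Sum> \<phi>(a\<^sub>k) b\<^sub>k\<close> depend on a
  presentation of them. Primeness bridges this: an estimate for
  \<open>x \<mapsto> \<Sum> a\<^sub>k x b\<^sub>k - x d\<close> passes with the same constant to the
  slice minus \<open>d\<close>. Here \<open>x d\<close> is treated as \<open>1 \<otimes> d\<close>
  and sliced to \<open>d\<close>, also when there is no unit. This agrees with
  \<open>\<phi> = 0\<close> in the nonunital case, which is the restriction of the character of the
  unitization that kills the algebra and sends \<open>1\<close> to \<open>1\<close>.

  Commutators see the slices only up to central elements; that the slices themselves converge comes
  from slicing \<open>E\<^sub>m - E\<^sub>n\<close> with \<open>d = 0\<close>.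

  Square roots and negative parts, built in the unitization from a norm criterion for positivity,
  take the place of spectral projections.\<close>

lemma scaleC_zero_left [simp]: "0 *\<^sub>C (x::'a::cstar_algebra) = 0"
  using norm_scaleC[of 0 x] by simp

lemma scaleC_zero_right [simp]: "c *\<^sub>C (0::'a::cstar_algebra) = 0"
  using norm_scaleC[of c "0::'a"] by simp

lemma scaleC_one [simp]: "1 *\<^sub>C (x::'a::cstar_algebra) = x"
  using scaleR_scaleC[of 1 x] by simp

lemma scaleC_minus_right: "c *\<^sub>C (- x) = - (c *\<^sub>C (x::'a::cstar_algebra))"
  using scaleC_add_right[of c x "- x"] by (simp add: add_eq_0_iff2 minus_equation_iff)

lemma scaleC_minus_left: "(- c) *\<^sub>C x = - (c *\<^sub>C (x::'a::cstar_algebra))"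
  using scaleC_add_left[of c "- c" x] by (simp add: add_eq_0_iff2 minus_equation_iff)

lemma scaleC_diff_right: "c *\<^sub>C (x - y) = c *\<^sub>C x - c *\<^sub>C (y::'a::cstar_algebra)"
  using scaleC_add_right[of c x "- y"] by (simp add: scaleC_minus_right)

lemma scaleC_diff_left: "(c - d) *\<^sub>C x = c *\<^sub>C x - d *\<^sub>C (x::'a::cstar_algebra)"
  using scaleC_add_left[of c "- d" x] by (simp add: scaleC_minus_left)

lemma scaleC_scaleR: "c *\<^sub>C r *\<^sub>R x = r *\<^sub>R c *\<^sub>C (x::'a::cstar_algebra)"
  by (simp add: scaleR_scaleC scaleC_scaleC mult.commute)

lemma adj_zero [simp]: "adj (0::'a::cstar_algebra) = 0"
  using adj_add[of "0::'a" 0] by simp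

lemma adj_minus: "adj (- x) = - adj (x::'a::cstar_algebra)"
  using adj_add[of x "- x"] by (simp add: add_eq_0_iff2 minus_equation_iff)

lemma adj_diff: "adj (x - y) = adj x - adj (y::'a::cstar_algebra)"
  using adj_add[of x "- y"] by (simp add: adj_minus)

lemma adj_scaleR: "adj (r *\<^sub>R x) = r *\<^sub>R adj (x::'a::cstar_algebra)"
  by (simp add: scaleR_scaleC adj_scaleC)

lemma adj_sum: "adj (sum f S) = (\<Sum>i\<in>S. adj (f i :: 'a::cstar_algebra))"
  by (induction S rule: infinite_finite_induct) (auto simp: adj_add)

lemmas adj_simps = adj_adj adj_add adj_diff adj_minus adj_scaleR adj_scaleC adj_mult

lemma norm_adj [simp]: "norm (adj x) = norm (x::'a::cstar_algebra)"
proof -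
  have le: "norm y \<le> norm (adj y)" for y :: 'a
  proof (cases "y = 0")
    case False
    have "norm y * norm y \<le> norm (adj y) * norm y"
      using norm_mult_ineq[of "adj y" y] by (simp add: cstar_identity power2_eq_square)
    with False show ?thesis by simp
  qed simp
  from le[of x] le[of "adj x"] show ?thesis by (simp add: adj_adj)
qed

lemma cstar_identity': "norm (x * adj x) = (norm (x::'a::cstar_algebra))\<^sup>2"
  using cstar_identity[of "adj x"] by (simp add: adj_adj)

lemma adj_mult_self_eq_0 [simp]: "adj x * x = 0 \<longleftrightarrow> (x::'a::cstar_algebra) = 0"
  using cstar_identity[of x] by auto

lemma mult_adj_self_eq_0 [simp]: "x * adj x = 0 \<longleftrightarrow> (x::'a::cstar_algebra) = 0"
  using cstar_identity'[of x] by auto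

lemma selfadjoint_square_eq_0: "adj x = x \<Longrightarrow> x * x = 0 \<longleftrightarrow> (x::'a::cstar_algebra) = 0"
  using adj_mult_self_eq_0[of x] by simp

lemma bounded_linear_adj: "bounded_linear (adj :: 'a::cstar_algebra \<Rightarrow> 'a)"
  by (rule bounded_linear_intro[of _ 1]) (auto simp: adj_add adj_scaleR)

lemma bounded_linear_scaleC: "bounded_linear (\<lambda>x::'a::cstar_algebra. c *\<^sub>C x)"
  by (rule bounded_linear_intro[of _ "cmod c"])
     (auto simp: scaleC_add_right scaleC_scaleR norm_scaleC)

lemma norm_le_of_mult_le:
  assumes "0 \<le> K" "\<And>x. norm (a * x) \<le> K * norm (x::'a::cstar_algebra)"
  shows "norm a \<le> K"
proof (cases "a = 0")
  case False
  have "norm a * norm a \<le> K * norm a"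
    using assms(2)[of "adj a"] by (simp add: cstar_identity' power2_eq_square)
  with False show ?thesis by simp
qed (use assms(1) in simp)

section \<open>Positive elements\<close>

class cstar_algebra_1 = cstar_algebra + real_normed_algebra_1

lemma adj_one [simp]: "adj (1::'a::cstar_algebra_1) = 1"
  using adj_mult[of "adj (1::'a)" 1] by (simp add: adj_adj)

lemma adj_of_real [simp]: "adj (of_real r :: 'a::cstar_algebra_1) = of_real r"
  by (simp add: of_real_def adj_scaleR)

text \<open>For selfadjoint \<open>x\<close> the inequality says that the spectrum lies in the
  interval from \<open>0\<close> to \<open>2 t\<close>. In this form, closure under sums is just the
  triangle inequality.\<close>

definition pos :: "'a::cstar_algebra_1 \<Rightarrow> bool" where
  "pos x \<longleftrightarrow> adj x = x \<and> (\<exists>t\<ge>0. norm (of_real t - x) \<le> t)"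

lemma pos_selfadjoint: "pos x \<Longrightarrow> adj x = x"
  by (simp add: pos_def)

lemma pos_0 [simp]: "pos 0"
  by (auto simp: pos_def)

lemma pos_add: "pos x \<Longrightarrow> pos y \<Longrightarrow> pos (x + y)"
proof -
  assume "pos x" "pos y"
  then obtain s t where st: "0 \<le> s" "0 \<le> t" "norm (of_real s - x) \<le> s" "norm (of_real t - y) \<le> t"
    and adj: "adj x = x" "adj y = y"
    by (auto simp: pos_def)
  have "norm (of_real (s + t) - (x + y)) \<le> norm (of_real s - x) + norm (of_real t - y)"
    by (metis norm_triangle_ineq add_diff_add of_real_add)
  with st adj show ?thesis
    by (auto simp: pos_def adj_add intro!: exI[of _ "s + t"])
qed

lemma pos_scaleR:
  assumes "pos x" "0 \<le> r" shows "pos (r *\<^sub>R x)"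
proof -
  obtain t where t: "0 \<le> t" "norm (of_real t - x) \<le> t" and adj: "adj x = x"
    using assms by (auto simp: pos_def)
  have "of_real (r * t) - r *\<^sub>R x = r *\<^sub>R (of_real t - x)"
    by (simp add: of_real_def scaleR_diff_right)
  then have "norm (of_real (r * t) - r *\<^sub>R x) \<le> r * t"
    using t assms by (simp add: mult_left_mono)
  then show ?thesis
    using t assms adj by (auto simp: pos_def adj_scaleR intro!: exI[of _ "r * t"])
qed

lemma pos_of_real: "0 \<le> r \<Longrightarrow> pos (of_real r)"
  by (auto simp: pos_def)

lemma pos_of_real_diff:
  assumes "adj x = x" "norm x \<le> t" shows "pos (of_real t - x)"
proof -
  have "0 \<le> t" using assms(2) norm_ge_zero order_trans by blast
  with assms show ?thesis by (auto simp: pos_def adj_diff intro!: exI[of _ t])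
qed

text \<open>\<open>1 - y\<close> is the square root of \<open>1 - c\<close>. The iteration \<open>y \<mapsto> (c + y\<^sup>2) / 2\<close> is dominated by the
  same iteration for the scalar \<open>c = 1\<close>, which is increasing and bounded.\<close>

lemma sqrt_one_minus:
  fixes c :: "'a::cstar_algebra_1"
  assumes c: "adj c = c" "norm c \<le> 1"
  obtains y where "adj y = y" "norm y \<le> 1" "\<And>z. z * c = c * z \<Longrightarrow> z * y = y * z"
    "(1 - y) * (1 - y) = 1 - c"
proof -
  define y where "y = rec_nat (0::'a) (\<lambda>_ y. (1/2) *\<^sub>R (c + y * y))"
  define s where "s = rec_nat (0::real) (\<lambda>_ s. (1 + s * s) / 2)"
  have y [simp]: "y 0 = 0" "y (Suc n) = (1/2) *\<^sub>R (c + y n * y n)" for n by (auto simp: y_def)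
  have s [simp]: "s 0 = 0" "s (Suc n) = (1 + s n * s n) / 2" for n by (auto simp: s_def)
  have s01: "0 \<le> s n \<and> s n \<le> 1" for n
    by (induction n) (auto simp: mult_le_one)
  have smono: "s n \<le> s (Suc n)" for n
    using sum_squares_ge_zero[of "s n - 1" 0] by (simp add: field_simps)
  have adjy: "adj (y n) = y n" for n
    by (induction n) (auto simp: adj_simps c)
  have comm: "z * y n = y n * z" if z: "z * c = c * z" for z n
  proof (induction n)
    case (Suc n)
    have "z * (y n * y n) = y n * y n * z" by (metis Suc mult.assoc)
    then show ?case using z by (simp add: algebra_simps)
  qed simp
  have ny: "norm (y n) \<le> s n" for n
  proof (induction n)
    case (Suc n)
    have "norm (c + y n * y n) \<le> 1 + s n * s n"
      by (intro norm_triangle_le add_mono c order_trans[OF norm_mult_ineq] mult_mono Suc)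
         (auto simp: s01)
    then show ?case by simp
  qed simp
  \<comment> \<open>Commuting iterates allow a difference of squares to be factored, which is what
    compares the increments of \<open>y\<close> with those of \<open>s\<close>.\<close>
  have cy: "y m * y n = y n * y m" for m n
    by (intro comm) (rule comm[of c, symmetric], simp)
  have dy: "norm (y (Suc n) - y n) \<le> s (Suc n) - s n" for n
  proof (induction n)
    case 0 then show ?case using c by simp
  next
    case (Suc n)
    have "y (Suc (Suc n)) - y (Suc n) = (1/2) *\<^sub>R (y (Suc n) * y (Suc n) - y n * y n)"
      unfolding y(2)[of "Suc n"] y(2)[of n] by (simp add: algebra_simps)
    also have "y (Suc n) * y (Suc n) - y n * y n = (y (Suc n) - y n) * (y (Suc n) + y n)"
      using cy[of n "Suc n"] by (simp only: algebra_simps)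
    finally have eq: "y (Suc (Suc n)) - y (Suc n) = (1/2) *\<^sub>R ((y (Suc n) - y n) * (y (Suc n) + y n))" .
    have "norm ((y (Suc n) - y n) * (y (Suc n) + y n)) \<le> (s (Suc n) - s n) * (s (Suc n) + s n)"
      by (intro order_trans[OF norm_mult_ineq] mult_mono Suc norm_triangle_le add_mono ny)
         (use smono[of n] in auto)
    also have "\<dots> = 2 * (s (Suc (Suc n)) - s (Suc n))"
      unfolding s(2)[of "Suc n"] s(2)[of n] by (simp add: field_simps)
    finally show ?case unfolding eq norm_scaleR by (simp del: y s)
  qed
  have "convergent s"
    using s01 incseqD[OF incseq_SucI[of s, OF smono]]
    by (intro Bseq_mono_convergent) (auto intro!: BseqI'[of _ 1] simp del: s)
  have dy': "norm (y (m + k) - y m) \<le> s (m + k) - s m" for m k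
  proof (induction k)
    case (Suc k)
    have "y (m + Suc k) - y m = (y (Suc (m + k)) - y (m + k)) + (y (m + k) - y m)" by simp
    then have "norm (y (m + Suc k) - y m) \<le> norm (y (Suc (m + k)) - y (m + k)) + norm (y (m + k) - y m)"
      by (metis norm_triangle_ineq)
    then show ?case using Suc dy[of "m + k"] by simp
  qed simp
  have dist_le: "dist (y m) (y n) \<le> dist (s m) (s n)" for m n
  proof (induction m n rule: linorder_wlog)
    case (le m n)
    with dy'[of m "n - m"] show ?case by (simp add: dist_norm norm_minus_commute)
  qed (simp add: dist_commute)
  have "Cauchy y"
  proof (rule metric_CauchyI)
    fix e :: real assume "0 < e"
    then obtain M where "\<And>m n. M \<le> m \<Longrightarrow> M \<le> n \<Longrightarrow> dist (s m) (s n) < e"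
      using metric_CauchyD[OF convergent_Cauchy[OF \<open>convergent s\<close>]] by blast
    then show "\<exists>M. \<forall>m\<ge>M. \<forall>n\<ge>M. dist (y m) (y n) < e"
      by (intro exI[of _ M] allI impI le_less_trans[OF dist_le])
  qed
  then obtain l where l: "y \<longlonglongrightarrow> l" using Cauchy_convergent convergent_def by blast
  show ?thesis
  proof
    show "adj l = l"
      using bounded_linear.tendsto[OF bounded_linear_adj l] l by (simp add: adjy LIMSEQ_unique)
    show "norm l \<le> 1"
      by (rule LIMSEQ_le_const2[OF tendsto_norm[OF l]]) (use ny s01 order_trans in blast)
    show "z * l = l * z" if "z * c = c * z" for z
      using tendsto_mult_left[OF l, of z] tendsto_mult_right[OF l, of z] comm[OF that]
      by (simp add: LIMSEQ_unique)
    have "(\<lambda>n. y (Suc n)) \<longlonglongrightarrow> (1/2) *\<^sub>R (c + l * l)"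
      unfolding y by (intro tendsto_intros l)
    with l have "l = (1/2) *\<^sub>R (c + l * l)"
      using LIMSEQ_Suc LIMSEQ_unique by blast
    then have "l + l = c + l * l" by (metis scaleR_half_double scaleR_left_distrib field_sum_of_halves scaleR_one scaleR_right_distrib)
    then show "(1 - l) * (1 - l) = 1 - c" by (simp add: algebra_simps)
  qed
qed

text \<open>Dividing by a witness \<open>t\<close> writes \<open>x / t\<close> as
  \<open>1 - c\<close> with \<open>\<parallel>c\<parallel> \<le> 1\<close>. The root commutes with
  everything that commutes with \<open>x\<close>; through this clause, roots of commuting elements
  commute.\<close>

lemma pos_sqrt:
  assumes "pos x"
  obtains d where "pos d" "d * d = x" "\<And>z. z * x = x * z \<Longrightarrow> z * d = d * z"
proof -
  obtain t where t: "0 \<le> t" "norm (of_real t - x) \<le> t" and x: "adj x = x"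
    using assms by (auto simp: pos_def)
  show ?thesis
  proof (cases "t = 0")
    case True
    with t have "x = 0" by simp
    then show ?thesis by (intro that[of 0]) auto
  next
    case False
    with t have t0: "t > 0" by simp
    define c where "c = (1/t) *\<^sub>R (of_real t - x)"
    have "adj c = c" using x by (simp add: c_def adj_simps)
    moreover have "norm c \<le> 1" using t t0 by (simp add: c_def del: scaleR_diff_right)
    ultimately obtain y where y: "adj y = y" "norm y \<le> 1" "\<And>z. z * c = c * z \<Longrightarrow> z * y = y * z"
      "(1 - y) * (1 - y) = 1 - c"
      using sqrt_one_minus[of c] by blast
    have c: "1 - c = (1/t) *\<^sub>R x"
      using t0 by (simp add: c_def scaleR_diff_right of_real_def)
    show ?thesis
    proof (rule that)
      show "pos (sqrt t *\<^sub>R (1 - y))"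
        using pos_of_real_diff[of y 1] y t0 by (intro pos_scaleR) auto
      show "sqrt t *\<^sub>R (1 - y) * sqrt t *\<^sub>R (1 - y) = x"
        using t0 by (simp add: y c)
      show "z * sqrt t *\<^sub>R (1 - y) = sqrt t *\<^sub>R (1 - y) * z" if z: "z * x = x * z" for z
      proof -
        have "z * c = c * z" using z by (simp add: c_def algebra_simps of_real_def)
        from y(3)[OF this] show ?thesis by (simp add: algebra_simps)
      qed
    qed
  qed
qed

text \<open>Together with \<open>norm_Re_le\<close> this turns knowledge of
  \<open>d\<^sup>2 + e\<^sup>2\<close> into norm bounds for \<open>d\<close> and \<open>e\<close>:
  the C*-identity gives the norm of \<open>d + \<i> e\<close>, which dominates both.\<close>

lemma adj_mult_self_commuting:
  fixes d e :: "'a::cstar_algebra"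
  assumes "adj d = d" "adj e = e" "d * e = e * d"
  shows "adj (d + \<i> *\<^sub>C e) * (d + \<i> *\<^sub>C e) = d * d + e * e"
  using assms by (simp add: adj_simps algebra_simps mult_scaleC_left mult_scaleC_right
      scaleC_scaleC scaleC_minus_left scaleC_add_right scaleC_diff_right)

lemma norm_Re_le:
  fixes d e :: "'a::cstar_algebra"
  assumes "adj d = d" "adj e = e"
  shows "norm d \<le> norm (d + \<i> *\<^sub>C e)" "norm e \<le> norm (d + \<i> *\<^sub>C e)"
proof -
  let ?u = "d + \<i> *\<^sub>C e"
  have "2 *\<^sub>R d = ?u + adj ?u"
    using assms by (simp add: adj_simps scaleC_minus_left scaleR_2)
  then have "2 * norm d = norm (?u + adj ?u)" by (metis norm_scaleR abs_numeral)
  then show "norm d \<le> norm ?u" using norm_triangle_ineq[of ?u "adj ?u"] by simp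
  have "\<i> *\<^sub>C (2 *\<^sub>R e) = ?u - adj ?u"
    using assms by (simp add: adj_simps scaleC_minus_left scaleR_2 scaleC_add_right)
  then have "2 * norm e = norm (?u - adj ?u)"
    by (metis norm_scaleC norm_ii mult_1 norm_scaleR abs_numeral)
  then show "norm e \<le> norm ?u" using norm_triangle_ineq4[of ?u "adj ?u"] by simp
qed

text \<open>For \<open>\<parallel>b\<parallel> \<le> 1\<close> the element \<open>b + \<i> \<surd>(1 - b\<^sup>2)\<close> is unitary.\<close>

lemma pos_square:
  fixes b :: "'a::cstar_algebra_1"
  assumes "adj b = b"
  shows "pos (b * b)"
proof -
  have unit: "pos (b * b)" if b: "adj b = b" "norm b \<le> 1" for b :: 'a
  proof -
    have "norm (b * b) \<le> 1"
      using norm_mult_ineq[of b b] b by (meson mult_le_one norm_ge_zero order_trans)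
    then obtain y where y: "adj y = y" "\<And>z. z * (b * b) = b * b * z \<Longrightarrow> z * y = y * z"
      "(1 - y) * (1 - y) = 1 - b * b"
      using sqrt_one_minus[of "b * b"] b by (metis adj_mult)
    define s where "s = 1 - y"
    have s: "adj s = s" "b * s = s * b"
      using y(1) y(2)[of b] by (auto simp: s_def adj_simps algebra_simps)
    have "adj (b + \<i> *\<^sub>C s) * (b + \<i> *\<^sub>C s) = 1"
      using adj_mult_self_commuting[OF b(1) s] y(3) by (simp add: s_def)
    then have "norm (b + \<i> *\<^sub>C s) = 1"
      using cstar_identity[of "b + \<i> *\<^sub>C s"] power2_eq_imp_eq[of "norm (b + \<i> *\<^sub>C s)" 1] by simp
    then have "norm s \<le> 1" using norm_Re_le(2)[OF b(1) s(1)] by simp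
    \<comment> \<open>Since \<open>1 - b\<^sup>2 = s\<^sup>2\<close>, positivity of
      \<open>b\<^sup>2\<close> holds with the witness \<open>t = 1\<close>.\<close>
    then have "norm (1 - b * b) \<le> 1"
      using norm_mult_ineq[of s s] y(3) unfolding s_def by (metis mult_le_one norm_ge_zero order_trans)
    then show ?thesis using b by (auto simp: pos_def adj_simps intro!: exI[of _ 1])
  qed
  show ?thesis
  proof (cases "b = 0")
    case False
    define b' where "b' = (1 / norm b) *\<^sub>R b"
    have "pos (b' * b')" using False assms by (intro unit) (auto simp: b'_def adj_simps)
    then have "pos ((norm b * norm b) *\<^sub>R (b' * b'))" by (intro pos_scaleR) auto
    then show ?thesis using False by (simp add: b'_def)
  qed simp
qed

section \<open>Order and norm\<close>

lemma pos_mult_commuting: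
  assumes "pos x" "pos y" "x * y = y * x"
  shows "pos (x * y)"
proof -
  obtain d where d: "pos d" "d * d = x" "\<And>z. z * x = x * z \<Longrightarrow> z * d = d * z"
    using pos_sqrt[OF assms(1)] by blast
  obtain e where e: "pos e" "e * e = y" "\<And>z. z * y = y * z \<Longrightarrow> z * e = e * z"
    using pos_sqrt[OF assms(2)] by blast
  have "y * d = d * y" using d(3)[of y] assms(3) by simp
  then have de: "d * e = e * d" using e(3)[of d] by simp
  have "adj (d * e) = d * e"
    using d(1) e(1) de by (simp add: pos_selfadjoint adj_mult)
  then have "pos (d * e * (d * e))" by (rule pos_square)
  also have "d * e * (d * e) = x * y" using de d(2) e(2) by (metis mult.assoc)
  finally show ?thesis .
qed

lemma pos_pair_sqrt:
  assumes "pos x" "pos y" "x * y = y * x"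
  obtains d e where "adj d = d" "adj e = e" "d * e = e * d" "d * d = x" "e * e = y"
proof -
  obtain d where d: "pos d" "d * d = x" "\<And>z. z * x = x * z \<Longrightarrow> z * d = d * z"
    using pos_sqrt[OF assms(1)] by blast
  obtain e where e: "pos e" "e * e = y" "\<And>z. z * y = y * z \<Longrightarrow> z * e = e * z"
    using pos_sqrt[OF assms(2)] by blast
  have "y * d = d * y" using d(3)[of y] assms(3) by simp
  then have "d * e = e * d" using e(3)[of d] by simp
  then show ?thesis using that d e pos_selfadjoint by blast
qed

text \<open>Roots \<open>d\<close> of \<open>x\<close> and \<open>e\<close> of \<open>- x\<close>
  satisfy \<open>d\<^sup>2 + e\<^sup>2 = 0\<close>, so \<open>d + \<i> e\<close> vanishes.\<close>

lemma pos_antisym: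
  assumes "pos x" "pos (- x)" shows "x = 0"
proof -
  obtain d e where de: "adj d = d" "adj e = e" "d * e = e * d" "d * d = x" "e * e = - x"
    using pos_pair_sqrt[OF assms] by auto
  have "adj (d + \<i> *\<^sub>C e) * (d + \<i> *\<^sub>C e) = 0"
    using adj_mult_self_commuting[OF de(1-3)] de by simp
  then have "d = 0" using norm_Re_le(1)[OF de(1,2)] by simp
  with de show ?thesis by simp
qed

lemma pos_of_real_iff: "pos (of_real t :: 'a::cstar_algebra_1) \<longleftrightarrow> 0 \<le> t"
proof
  assume p: "pos (of_real t :: 'a)"
  show "0 \<le> t"
  proof (rule ccontr)
    assume "\<not> 0 \<le> t"
    then have "pos (- of_real t :: 'a)" using pos_of_real[of "- t"] by simp
    from pos_antisym[OF p this] \<open>\<not> 0 \<le> t\<close> show False by simp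
  qed
qed (rule pos_of_real)

text \<open>Roots \<open>d\<close> of \<open>a\<close> and \<open>e\<close> of \<open>t - a\<close>
  satisfy \<open>d\<^sup>2 + e\<^sup>2 = t\<close>, so
  \<open>\<parallel>d\<parallel>\<^sup>2\<close> is at most
  \<open>\<parallel>d + \<i> e\<parallel>\<^sup>2 = t\<close>.\<close>

lemma norm_le_of_pos:
  assumes "pos a" "pos (of_real t - a)"
  shows "norm a \<le> t"
proof -
  have "pos (of_real t :: 'a)" using pos_add[OF assms] by simp
  then have t: "0 \<le> t" by (simp add: pos_of_real_iff)
  obtain d e where de: "adj d = d" "adj e = e" "d * e = e * d" "d * d = a" "e * e = of_real t - a"
    using pos_pair_sqrt[OF assms] by (auto simp: algebra_simps of_real_def)
  have "adj (d + \<i> *\<^sub>C e) * (d + \<i> *\<^sub>C e) = of_real t"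
    using adj_mult_self_commuting[OF de(1-3)] de by simp
  then have "(norm (d + \<i> *\<^sub>C e))\<^sup>2 = t"
    using cstar_identity[of "d + \<i> *\<^sub>C e"] t by simp
  moreover have "norm a = (norm d)\<^sup>2" using cstar_identity[of d] de by simp
  ultimately show ?thesis using norm_Re_le(1)[OF de(1,2)] by (metis norm_ge_zero power_mono)
qed

lemma pos_norm_mono:
  assumes "pos a" "pos (b - a)" shows "norm a \<le> norm b"
proof -
  have "pos b" using pos_add[OF assms] by simp
  then have "pos (of_real (norm b) - b)" by (intro pos_of_real_diff pos_selfadjoint) auto
  from pos_add[OF this assms(2)] have "pos (of_real (norm b) - a)" by simp
  with assms(1) show ?thesis by (rule norm_le_of_pos)
qed

text \<open>The product of the two commuting positive elements is
  \<open>t\<^sup>2 - x\<^sup>2\<close>, which reduces the claim to the positive element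
  \<open>x\<^sup>2\<close>.\<close>

lemma norm_le_of_pos_both:
  assumes "pos (of_real t - x)" "pos (of_real t + x)"
  shows "norm x \<le> t"
proof -
  have x: "adj x = x" using pos_selfadjoint[OF assms(2)] by (simp add: adj_add)
  have "of_real t - x + (of_real t + x) = of_real t + of_real t" by simp
  also have "\<dots> = of_real (t + t)" by (rule of_real_add[symmetric])
  finally have "of_real t - x + (of_real t + x) = of_real (t + t)" .
  with pos_add[OF assms] have "pos (of_real (t + t) :: 'a)" by (simp only:)
  then have "0 \<le> t + t" by (simp only: pos_of_real_iff)
  then have t: "0 \<le> t" by simp
  have "pos ((of_real t - x) * (of_real t + x))"
    by (intro pos_mult_commuting assms) (simp add: algebra_simps of_real_def)
  also have "(of_real t - x) * (of_real t + x) = of_real (t * t) - x * x"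
    by (simp add: algebra_simps of_real_def)
  finally have "norm (x * x) \<le> t * t" by (intro norm_le_of_pos pos_square x)
  then have "(norm x)\<^sup>2 \<le> t\<^sup>2" using cstar_identity[of x] x by (simp add: power2_eq_square)
  from power2_le_imp_le[OF this t] show ?thesis .
qed

text \<open>The element \<open>n\<close> is the negative part of \<open>x\<close>; it is obtained here with \<open>n\<^sup>3 \<ge> 0\<close> in place of
  \<open>n \<ge> 0\<close>.\<close>

lemma negative_part:
  fixes x :: "'a::cstar_algebra_1"
  assumes x: "adj x = x" and "\<not> pos x"
  obtains n where "adj n = n" "n \<noteq> 0" "n * x = - (n * n)" "x * n = - (n * n)" "pos (n * n * n)"
proof -
  obtain m where m: "pos m" "m * m = x * x" "\<And>z. z * (x * x) = x * x * z \<Longrightarrow> z * m = m * z"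
    using pos_sqrt[OF pos_square[OF x]] by blast
  have xm: "x * m = m * x" using m(3)[of x] by (simp add: mult.assoc)
  \<comment> \<open>\<open>m\<close> has the role of the absolute value of \<open>x\<close>; this is
    the usual formula for the negative part.\<close>
  define n where "n = (1/2) *\<^sub>R (m - x)"
  have 1: "adj n = n" using pos_selfadjoint[OF m(1)] x by (simp add: n_def adj_simps)
  have 2: "n \<noteq> 0" using m(1) assms(2) by (auto simp: n_def)
  have "(m - x) * (m - x) = - (2 *\<^sub>R ((m - x) * x))"
    using xm m(2) by (simp add: algebra_simps scaleR_2)
  then have nx: "n * x = - (n * n)" by (simp add: n_def)
  have "(m - x) * (m - x) = - (2 *\<^sub>R (x * (m - x)))"
    using xm m(2) by (simp add: algebra_simps scaleR_2)
  then have xn: "x * n = - (n * n)" by (simp add: n_def)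
  have "(m - x) * (m - x) = 2 *\<^sub>R ((m - x) * m)" "(m - x) * (m - x) = 2 *\<^sub>R (m * (m - x))"
    using xm m(2) by (simp_all add: algebra_simps scaleR_2)
  then have nm: "n * m = n * n" "m * n = n * n" by (simp_all add: n_def)
  have nnm: "n * n * m = n * n * n" "m * (n * n) = n * n * n"
    by (simp only: mult.assoc nm, simp only: mult.assoc[symmetric] nm)
  \<comment> \<open>Because \<open>n m = n\<^sup>2\<close>, the cube is a product of the commuting
    positive elements \<open>n\<^sup>2\<close> and \<open>m\<close>; positivity of \<open>n\<close>
    does not enter.\<close>
  have "pos (n * n * m)"
    by (intro pos_mult_commuting pos_square 1 m(1)) (simp only: nnm)
  then have "pos (n * n * n)" by (simp only: nnm)
  with that 1 2 nx xn show ?thesis by blast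
qed

text \<open>Up to sign, \<open>p\<close> and \<open>q\<close> are twice the real and imaginary parts
  of \<open>y\<close>, and the sum of their squares is twice the element in question.\<close>

lemma pos_add_conjugate:
  fixes y :: "'a::cstar_algebra_1"
  shows "pos (adj y * y + y * adj y)"
proof -
  define p q where "p = y + adj y" and "q = \<i> *\<^sub>C (y - adj y)"
  have "pos ((1/2) *\<^sub>R (p * p + q * q))"
    by (intro pos_scaleR pos_add pos_square)
       (auto simp: p_def q_def adj_simps algebra_simps scaleC_minus_left scaleC_diff_right)
  also have "p * p + q * q = 2 *\<^sub>R (adj y * y + y * adj y)"
    by (simp add: p_def q_def mult_scaleC_left mult_scaleC_right scaleC_scaleC scaleC_minus_left
        scaleC_diff_right algebra_simps scaleR_2)
  finally show ?thesis by simp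
qed

text \<open>With \<open>k = y y\<^sup>*\<close> and \<open>g = - y\<^sup>* y\<close> both positive, \<open>y (1 - g)\<^sup>n y\<^sup>* = (1 + k)\<^sup>n k\<close> is bounded in \<open>n\<close>
  and at least \<open>n k\<^sup>2\<close>.\<close>

lemma eq_0_of_pos_minus_adj_mult_self:
  fixes y :: "'a::cstar_algebra_1"
  assumes "pos (- (adj y * y))"
  shows "y = 0"
proof -
  have unit: "y = 0" if g: "pos (- (adj y * y))" and y1: "norm y \<le> 1" for y :: 'a
  proof -
    define k g where "k = y * adj y" and "g = - (adj y * y)"
    \<comment> \<open>\<open>y y\<^sup>*\<close> is the sum of \<open>g = - y\<^sup>* y\<close> and
      the positive element of \<open>pos_add_conjugate\<close>.\<close>
    have k: "pos k" using pos_add[OF g pos_add_conjugate[of y]] by (simp add: k_def)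
    have sq: "(norm y)\<^sup>2 \<le> 1" using y1 by (simp add: power_le_one)
    have ng: "norm (1 - g) \<le> 1"
    proof (rule norm_le_of_pos)
      show "pos (1 - g)"
        using pos_of_real_diff[of g 1] g sq by (simp add: g_def adj_simps cstar_identity)
      show "pos (of_real 1 - (1 - g))" using g by (simp add: g_def)
    qed
    have pow: "y * (1 - g) ^ n = (1 + k) ^ n * y" for n
    proof (induction n)
      case (Suc n)
      have "y * (1 - g) ^ Suc n = (1 + k) ^ n * (y * (1 - g))"
        by (simp add: power_Suc2 Suc mult.assoc[symmetric] del: power_Suc)
      also have "y * (1 - g) = (1 + k) * y" by (simp add: g_def k_def algebra_simps)
      finally show ?case by (simp add: power_Suc2 mult.assoc del: power_Suc)
    qed simp
    have bound: "norm ((1 + k) ^ n * k) \<le> 1" for n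
    proof -
      have "(1 + k) ^ n * k = y * (1 - g) ^ n * adj y" by (simp add: pow k_def mult.assoc)
      also have "norm \<dots> \<le> norm y * norm ((1 - g) ^ n) * norm (adj y)"
        by (intro order_trans[OF norm_mult_ineq] mult_right_mono norm_mult_ineq) auto
      also have "\<dots> \<le> 1 * 1 * 1"
        using y1 ng norm_power_ineq[of "1 - g" n] power_le_one[of "norm (1 - g)" n]
        by (intro mult_mono) auto
      finally show ?thesis by simp
    qed
    have comm: "k * (1 + k) ^ n = (1 + k) ^ n * k" for n
      by (rule power_commuting_commutes[symmetric]) (simp add: algebra_simps)
    \<comment> \<open>Bernoulli's inequality \<open>(1 + k)\<^sup>n \<ge> 1 + n k\<close>,
      multiplied by \<open>k\<close>.\<close>
    have step: "pos ((1 + k) ^ n * k - k - real n *\<^sub>R (k * k))" for n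
    proof (induction n)
      case (Suc n)
      let ?D = "(1 + k) ^ n * k - k - real n *\<^sub>R (k * k)"
      have "(1 + k) ^ Suc n * k - k - real (Suc n) *\<^sub>R (k * k) = (1 + k) * ?D + real n *\<^sub>R (k * k * k)"
        by (simp add: algebra_simps)
      moreover have "k * ((1 + k) ^ n * k) = (1 + k) ^ n * (k * k)"
        by (metis comm mult.assoc)
      then have "pos ((1 + k) * ?D)"
        using pos_add[OF pos_of_real[of 1] k] Suc
        by (intro pos_mult_commuting) (auto simp: algebra_simps)
      moreover have "pos (real n *\<^sub>R (k * k * k))"
        by (intro pos_scaleR pos_mult_commuting k) (auto simp: mult.assoc)
      ultimately show ?case by (simp add: pos_add)
    qed simp
    have le: "real n * norm (k * k) \<le> 1" for n
    proof -
      have "norm (real n *\<^sub>R (k * k)) \<le> norm ((1 + k) ^ n * k)"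
        using pos_add[OF step[of n] k]
        by (intro pos_norm_mono pos_scaleR pos_mult_commuting k) auto
      with bound[of n] show ?thesis by simp
    qed
    have "norm (k * k) = 0"
    proof (rule ccontr)
      assume "norm (k * k) \<noteq> 0"
      then obtain n where "1 < real n * norm (k * k)"
        using reals_Archimedean3[of "norm (k * k)"] by auto
      with le[of n] show False by simp
    qed
    then have "k = 0" using k selfadjoint_square_eq_0 pos_selfadjoint by auto
    then show ?thesis by (simp add: k_def)
  qed
  define y' where "y' = (1 / norm y) *\<^sub>R y"
  have "pos ((1 / norm y * (1 / norm y)) *\<^sub>R (- (adj y * y)))"
    by (intro pos_scaleR assms) auto
  then have "pos (- (adj y' * y'))" by (simp add: y'_def adj_scaleR)
  then have "y' = 0" by (rule unit) (simp add: y'_def)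
  then show ?thesis by (auto simp: y'_def)
qed

text \<open>If \<open>n\<close> is the negative part of \<open>x\<^sup>* x\<close>, then
  \<open>(x n)\<^sup>* (x n) = - n\<^sup>3\<close> is negative. The preceding lemma gives
  \<open>x n = 0\<close>, hence \<open>n\<^sup>3 = 0\<close> and \<open>n = 0\<close>.\<close>

theorem pos_adj_mult_self:
  fixes x :: "'a::cstar_algebra_1"
  shows "pos (adj x * x)"
proof (rule ccontr)
  assume np: "\<not> pos (adj x * x)"
  have "adj (adj x * x) = adj x * x" by (simp add: adj_simps)
  then obtain n where n: "adj n = n" "n \<noteq> 0" "n * (adj x * x) = - (n * n)" "pos (n * n * n)"
    using negative_part[OF _ np] by blast
  have "adj (x * n) * (x * n) = n * (adj x * x) * n" by (simp add: adj_mult n(1) mult.assoc)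
  then have eq: "adj (x * n) * (x * n) = - (n * n * n)" by (simp add: n(3))
  with n(4) have "x * n = 0" by (intro eq_0_of_pos_minus_adj_mult_self) simp
  with eq have "n * n * n = 0" by simp
  then have "n * n * (n * n) = 0" by (simp add: mult.assoc[symmetric])
  with n(1,2) show False
    using selfadjoint_square_eq_0[of "n * n"] selfadjoint_square_eq_0[of n] by (simp add: adj_mult)
qed

lemma pos_conj:
  assumes "pos x" shows "pos (adj z * x * z)"
proof -
  obtain d where d: "pos d" "d * d = x" using pos_sqrt[OF assms] by blast
  have "adj z * x * z = adj (d * z) * (d * z)"
    using d by (auto simp: adj_mult pos_selfadjoint mult.assoc)
  then show ?thesis by (simp add: pos_adj_mult_self)
qed

section \<open>Unitization\<close>

text \<open>The norm is the maximum of the norms in the two representations of \<open>a + c\<close>, by left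
  multiplication on the algebra and by \<open>c\<close> on the complex numbers. Unlike the operator norm alone it
  also works for algebras that already have a unit.\<close>

datatype 'a unitization = Unitization (vec_part: 'a) (scalar_part: complex)

lemma unitization_eq_iff: "u = v \<longleftrightarrow> vec_part u = vec_part v \<and> scalar_part u = scalar_part v"
  by (auto intro: unitization.expand)

definition left_action :: "'a::cstar_algebra unitization \<Rightarrow> 'a \<Rightarrow> 'a" where
  "left_action u x = vec_part u * x + scalar_part u *\<^sub>C x"

lemma bounded_linear_left_action: "bounded_linear (left_action u)"
  unfolding left_action_def
  by (intro bounded_linear_add bounded_linear_mult_right bounded_linear_scaleC)

lemma onorm_left_action_le: "onorm (left_action u) \<le> norm (vec_part u) + cmod (scalar_part u)"
proof (rule onorm_bound)
  fix x
  have "norm (left_action u x) \<le> norm (vec_part u * x) + norm (scalar_part u *\<^sub>C x)"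
    unfolding left_action_def by (rule norm_triangle_ineq)
  also have "\<dots> \<le> (norm (vec_part u) + cmod (scalar_part u)) * norm x"
    using norm_mult_ineq[of "vec_part u" x] by (simp add: norm_scaleC algebra_simps)
  finally show "norm (left_action u x) \<le> (norm (vec_part u) + cmod (scalar_part u)) * norm x" .
qed simp

text \<open>Together with \<open>onorm_left_action_le\<close> this makes the maximum norm equivalent
  to the sum of the norms of the two parts; definiteness and completeness of the unitization
  follow.\<close>

lemma norm_vec_part_le: "norm (vec_part u) \<le> onorm (left_action u) + cmod (scalar_part u)"
proof (rule norm_le_of_mult_le)
  show "0 \<le> onorm (left_action u) + cmod (scalar_part u)"
    by (intro add_nonneg_nonneg onorm_pos_le bounded_linear_left_action) simp
  fix x
  have "vec_part u * x = left_action u x - scalar_part u *\<^sub>C x"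
    by (simp add: left_action_def)
  then have "norm (vec_part u * x) \<le> norm (left_action u x) + norm (scalar_part u *\<^sub>C x)"
    by (metis norm_triangle_ineq4)
  also have "\<dots> \<le> (onorm (left_action u) + cmod (scalar_part u)) * norm x"
    using onorm[OF bounded_linear_left_action, of u x] by (simp add: norm_scaleC algebra_simps)
  finally show "norm (vec_part u * x) \<le> (onorm (left_action u) + cmod (scalar_part u)) * norm x" .
qed

instantiation unitization :: (cstar_algebra) real_normed_algebra_1
begin

definition "0 = Unitization 0 0"
definition "1 = Unitization 0 1"
definition "u + v = Unitization (vec_part u + vec_part v) (scalar_part u + scalar_part v)"
definition "u - v = Unitization (vec_part u - vec_part v) (scalar_part u - scalar_part v)"
definition "- u = Unitization (- vec_part u) (- scalar_part u)"
definition "u * v = Unitization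
  (vec_part u * vec_part v + scalar_part u *\<^sub>C vec_part v + scalar_part v *\<^sub>C vec_part u)
  (scalar_part u * scalar_part v)"
definition "r *\<^sub>R u = Unitization (r *\<^sub>R vec_part u) (r *\<^sub>R scalar_part u)"
definition "norm u = max (onorm (left_action u)) (cmod (scalar_part u))"
definition "sgn u = inverse (norm u) *\<^sub>R (u::'a unitization)"
definition "dist u v = norm (u - v :: 'a unitization)"
definition [code del]: "(uniformity :: ('a unitization \<times> 'a unitization) filter) =
  (INF e\<in>{0<..}. principal {(x, y). dist x y < e})"
definition [code del]: "open (U :: 'a unitization set) \<longleftrightarrow>
  (\<forall>x\<in>U. eventually (\<lambda>(x', y). x' = x \<longrightarrow> y \<in> U) uniformity)"

lemma unitization_parts [simp]:
  "vec_part (0 :: 'a unitization) = 0" "scalar_part (0 :: 'a unitization) = 0"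
  "vec_part (1 :: 'a unitization) = 0" "scalar_part (1 :: 'a unitization) = 1"
  "vec_part (u + v) = vec_part u + vec_part v" "scalar_part (u + v) = scalar_part u + scalar_part v"
  "vec_part (u - v) = vec_part u - vec_part v" "scalar_part (u - v) = scalar_part u - scalar_part v"
  "vec_part (- u) = - vec_part u" "scalar_part (- u) = - scalar_part u"
  "vec_part (u * v) = vec_part u * vec_part v + scalar_part u *\<^sub>C vec_part v + scalar_part v *\<^sub>C vec_part u"
  "scalar_part (u * v) = scalar_part u * scalar_part v"
  "vec_part (r *\<^sub>R u) = r *\<^sub>R vec_part u" "scalar_part (r *\<^sub>R u) = r *\<^sub>R scalar_part u"
  for u v :: "'a unitization"
  by (simp_all add: zero_unitization_def one_unitization_def plus_unitization_def
      minus_unitization_def uminus_unitization_def times_unitization_def scaleR_unitization_def)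

lemma left_action_simps:
  "left_action (u + v) = (\<lambda>x. left_action u x + left_action v x)"
  "left_action (r *\<^sub>R u) = (\<lambda>x. r *\<^sub>R left_action u x)"
  "left_action (u * v) = left_action u \<circ> left_action v"
  "left_action (1 :: 'a unitization) = (\<lambda>x. x)"
  "left_action (0 :: 'a unitization) = (\<lambda>x. 0)"
  by (auto simp: left_action_def fun_eq_iff algebra_simps scaleC_add_left scaleC_add_right
      scaleC_scaleC mult_scaleC_left mult_scaleC_right scaleR_scaleC scaleR_conv_of_real[where 'a = complex])

instance
proof
  fix u v w :: "'a unitization" and r s :: real
  show "u + v + w = u + (v + w)" "u + v = v + u" "0 + u = u" "- u + u = 0" "u - v = u + - v"
    "r *\<^sub>R (u + v) = r *\<^sub>R u + r *\<^sub>R v" "(r + s) *\<^sub>R u = r *\<^sub>R u + s *\<^sub>R u"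
    "r *\<^sub>R s *\<^sub>R u = (r * s) *\<^sub>R u" "1 *\<^sub>R u = u" "1 * u = u" "u * 1 = u" "(0::'a unitization) \<noteq> 1"
    by (auto simp: unitization_eq_iff algebra_simps)
  show "u * v * w = u * (v * w)" "(u + v) * w = u * w + v * w" "u * (v + w) = u * v + u * w"
    "r *\<^sub>R u * v = r *\<^sub>R (u * v)" "u * r *\<^sub>R v = r *\<^sub>R (u * v)"
    by (auto simp: unitization_eq_iff algebra_simps scaleC_add_left scaleC_add_right
      scaleC_scaleC mult_scaleC_left mult_scaleC_right scaleR_scaleC scaleR_conv_of_real[where 'a = complex])
  show "dist u v = norm (u - v)" "sgn u = inverse (norm u) *\<^sub>R u"
    by (simp_all add: dist_unitization_def sgn_unitization_def)
  show "(uniformity :: ('a unitization \<times> 'a unitization) filter) = (INF e\<in>{0<..}. principal {(x, y). dist x y < e})"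
    by (rule uniformity_unitization_def)
  show "open U \<longleftrightarrow> (\<forall>x\<in>U. eventually (\<lambda>(x', y). x' = x \<longrightarrow> y \<in> U) uniformity)"
    for U :: "'a unitization set"
    by (rule open_unitization_def)
  have nonneg: "0 \<le> onorm (left_action u)" for u :: "'a unitization"
    by (rule onorm_pos_le[OF bounded_linear_left_action])
  show "norm u = 0 \<longleftrightarrow> u = 0"
  proof
    assume "norm u = 0"
    then have "onorm (left_action u) = 0" "cmod (scalar_part u) = 0"
      using nonneg[of u] norm_ge_zero[of "scalar_part u"]
      unfolding norm_unitization_def by linarith+
    with norm_vec_part_le[of u] show "u = 0" by (simp add: unitization_eq_iff)
  qed (simp add: norm_unitization_def left_action_simps onorm_zero)
  show "norm (u + v) \<le> norm u + norm v"
    using onorm_triangle[OF bounded_linear_left_action bounded_linear_left_action, of u v]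
      norm_triangle_ineq[of "scalar_part u" "scalar_part v"]
    unfolding norm_unitization_def left_action_simps unitization_parts by linarith
  show "norm (r *\<^sub>R u) = \<bar>r\<bar> * norm u"
    unfolding norm_unitization_def left_action_simps unitization_parts
    by (simp add: onorm_scaleR[OF bounded_linear_left_action] max_mult_distrib_left)
  have "onorm (left_action u \<circ> left_action v) \<le> onorm (left_action u) * onorm (left_action v)"
    by (intro onorm_compose bounded_linear_left_action)
  also have "\<dots> \<le> norm u * norm v"
    by (intro mult_mono) (auto simp: norm_unitization_def nonneg le_max_iff_disj)
  finally have "onorm (left_action (u * v)) \<le> norm u * norm v" by (simp only: left_action_simps)
  moreover have "cmod (scalar_part (u * v)) \<le> norm u * norm v"
    unfolding unitization_parts norm_mult
    by (intro mult_mono) (auto simp: norm_unitization_def nonneg le_max_iff_disj)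
  ultimately show "norm (u * v) \<le> norm u * norm v"
    unfolding norm_unitization_def[of "u * v"] by simp
  have "onorm (\<lambda>x::'a. x) \<le> 1" by (rule onorm_id_le)
  then show "norm (1 :: 'a unitization) = 1"
    by (simp add: norm_unitization_def left_action_simps)
qed

end

lemma cmod_scalar_part_le: "cmod (scalar_part u) \<le> norm u"
  by (simp add: norm_unitization_def)

lemma norm_vec_part_le_norm: "norm (vec_part u) \<le> 2 * norm u"
  using norm_vec_part_le[of u] unfolding norm_unitization_def by linarith

lemma norm_unitization_le: "norm u \<le> norm (vec_part u) + cmod (scalar_part u)"
  using onorm_left_action_le[of u] by (simp add: norm_unitization_def)

instance unitization :: (cstar_algebra) banach
proof
  fix X :: "nat \<Rightarrow> 'a unitization"
  assume X: "Cauchy X"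
  have "Cauchy (\<lambda>n. vec_part (X n))"
  proof (rule CauchyI)
    fix e :: real assume "0 < e"
    then obtain M where "\<And>m n. M \<le> m \<Longrightarrow> M \<le> n \<Longrightarrow> norm (X m - X n) < e / 2"
      using CauchyD[OF X, of "e / 2"] by auto
    then have "norm (vec_part (X m) - vec_part (X n)) < e" if "M \<le> m" "M \<le> n" for m n
      using norm_vec_part_le_norm[of "X m - X n"] that by fastforce
    then show "\<exists>M. \<forall>m\<ge>M. \<forall>n\<ge>M. norm (vec_part (X m) - vec_part (X n)) < e" by blast
  qed
  then obtain a where a: "(\<lambda>n. vec_part (X n)) \<longlonglongrightarrow> a"
    using Cauchy_convergent convergent_def by blast
  have "Cauchy (\<lambda>n. scalar_part (X n))"
  proof (rule CauchyI)
    fix e :: real assume "0 < e"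
    then obtain M where "\<And>m n. M \<le> m \<Longrightarrow> M \<le> n \<Longrightarrow> norm (X m - X n) < e"
      using CauchyD[OF X, of e] by auto
    then have "norm (scalar_part (X m) - scalar_part (X n)) < e" if "M \<le> m" "M \<le> n" for m n
      using cmod_scalar_part_le[of "X m - X n"] that by fastforce
    then show "\<exists>M. \<forall>m\<ge>M. \<forall>n\<ge>M. norm (scalar_part (X m) - scalar_part (X n)) < e" by blast
  qed
  then obtain c where c: "(\<lambda>n. scalar_part (X n)) \<longlonglongrightarrow> c"
    using Cauchy_convergent convergent_def by blast
  have "(\<lambda>n. norm (vec_part (X n) - a) + cmod (scalar_part (X n) - c)) \<longlonglongrightarrow> 0"
    using tendsto_add[OF tendsto_norm[OF LIM_zero[OF a]] tendsto_norm[OF LIM_zero[OF c]]] by simp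
  then have "(\<lambda>n. X n - Unitization a c) \<longlonglongrightarrow> 0"
    by (rule Lim_null_comparison[rotated])
       (use norm_unitization_le[of "X _ - Unitization a c"] in simp)
  then show "convergent X" using LIM_zero_cancel convergent_def by blast
qed

instantiation unitization :: (cstar_algebra) cstar_algebra
begin

definition "c *\<^sub>C u = Unitization (c *\<^sub>C vec_part u) (c * scalar_part u)"
definition "adj u = Unitization (adj (vec_part u)) (cnj (scalar_part u))"

lemma unitization_parts' [simp]:
  "vec_part (c *\<^sub>C u) = c *\<^sub>C vec_part u" "scalar_part (c *\<^sub>C u) = c * scalar_part u"
  "vec_part (adj u) = adj (vec_part u)" "scalar_part (adj u) = cnj (scalar_part u)"
  for u :: "'a unitization"
  by (simp_all add: scaleC_unitization_def adj_unitization_def)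

text \<open>Left multiplication is adjointable for the algebra-valued inner product
  \<open>x\<^sup>* y\<close>. This yields the C*-identity for its operator norm, just as on a
  Hilbert space.\<close>

lemma left_action_adj:
  fixes u :: "'a unitization"
  shows "adj (left_action u x) * y = adj x * left_action (adj u) y"
  by (simp add: left_action_def adj_simps algebra_simps mult_scaleC_left mult_scaleC_right)

lemma onorm_left_action_sq: "(onorm (left_action u))\<^sup>2 \<le> onorm (left_action (adj u * u))"
  for u :: "'a unitization"
proof -
  let ?K = "onorm (left_action (adj u * u))"
  have K: "0 \<le> ?K" by (rule onorm_pos_le[OF bounded_linear_left_action])
  have "onorm (left_action u) \<le> sqrt ?K"
  proof (rule onorm_bound)
    fix x
    have "(norm (left_action u x))\<^sup>2 = norm (adj x * left_action (adj u * u) x)"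
      by (simp add: cstar_identity[symmetric] left_action_adj left_action_simps)
    also have "\<dots> \<le> norm x * (?K * norm x)"
      using norm_mult_ineq[of "adj x" "left_action (adj u * u) x"]
        onorm[OF bounded_linear_left_action, of "adj u * u" x]
      by (simp add: mult_left_mono order_trans)
    also have "\<dots> = (sqrt ?K * norm x)\<^sup>2" using K by (simp add: power2_eq_square)
    finally show "norm (left_action u x) \<le> sqrt ?K * norm x"
      by (rule power2_le_imp_le) (simp add: K)
  qed (simp add: K)
  then show ?thesis
    using K power_mono[OF _ onorm_pos_le[OF bounded_linear_left_action], of u "sqrt ?K" 2] by simp
qed

instance
proof
  fix u v :: "'a unitization" and c d :: complex and r :: real
  show "c *\<^sub>C (u + v) = c *\<^sub>C u + c *\<^sub>C v" "(c + d) *\<^sub>C u = c *\<^sub>C u + d *\<^sub>C u"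
    "c *\<^sub>C d *\<^sub>C u = (c * d) *\<^sub>C u" "r *\<^sub>R u = complex_of_real r *\<^sub>C u"
    "c *\<^sub>C u * v = c *\<^sub>C (u * v)" "u * c *\<^sub>C v = c *\<^sub>C (u * v)"
    "adj (adj u) = u" "adj (u + v) = adj u + adj v" "adj (c *\<^sub>C u) = cnj c *\<^sub>C adj u"
    "adj (u * v) = adj v * adj u"
    by (auto simp: unitization_eq_iff algebra_simps scaleC_add_left scaleC_add_right
      scaleC_scaleC mult_scaleC_left mult_scaleC_right scaleR_scaleC adj_simps scaleR_conv_of_real[where 'a = complex])
  have "onorm (left_action (c *\<^sub>C u)) = cmod c * onorm (left_action u)"
  proof -
    have "left_action (c *\<^sub>C u) = (\<lambda>x. c *\<^sub>C left_action u x)"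
      by (auto simp: left_action_def scaleC_add_right scaleC_scaleC mult_scaleC_left)
    then have "onorm (left_action (c *\<^sub>C u)) = (SUP x. cmod c * (norm (left_action u x) / norm x))"
      by (simp add: onorm_def norm_scaleC)
    also have "\<dots> = onorm (\<lambda>x. cmod c *\<^sub>R left_action u x)" by (simp add: onorm_def)
    finally show ?thesis using onorm_scaleR[OF bounded_linear_left_action, of "cmod c" u] by simp
  qed
  then show "norm (c *\<^sub>C u) = cmod c * norm u"
    by (simp add: norm_unitization_def norm_mult max_mult_distrib_left)
  have nonneg: "0 \<le> onorm (left_action u)" for u :: "'a unitization"
    by (rule onorm_pos_le[OF bounded_linear_left_action])
  have sq: "(norm u)\<^sup>2 \<le> norm (adj u * u)" for u :: "'a unitization"
  proof (cases "onorm (left_action u) \<le> cmod (scalar_part u)")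
    case True
    then have "(norm u)\<^sup>2 = cmod (scalar_part (adj u * u))"
      by (simp add: norm_unitization_def norm_mult power2_eq_square)
    then show ?thesis using cmod_scalar_part_le by metis
  next
    case False
    then have "(norm u)\<^sup>2 = (onorm (left_action u))\<^sup>2" by (simp add: norm_unitization_def)
    also have "\<dots> \<le> norm (adj u * u)"
      using onorm_left_action_sq[of u] by (simp add: norm_unitization_def[of "adj u * u"])
    finally show ?thesis .
  qed
  \<comment> \<open>The inequality \<open>sq\<close> already forces \<open>adj\<close> to be
    isometric, and isometry supplies the reverse inequality.\<close>
  have le: "norm u \<le> norm (adj u)" for u :: "'a unitization"
  proof (cases "u = 0")
    case False
    have "norm u * norm u \<le> norm (adj u) * norm u"
      using sq[of u] norm_mult_ineq[of "adj u" u] by (simp add: power2_eq_square)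
    with False show ?thesis by simp
  qed simp
  have "adj (adj u) = u" by (simp add: unitization_eq_iff adj_adj)
  then have "norm (adj u) = norm u" using le[of u] le[of "adj u"] by simp
  then show "norm (adj u * u) = (norm u)\<^sup>2"
    using sq[of u] norm_mult_ineq[of "adj u" u] by (simp add: power2_eq_square)
qed

end

instance unitization :: (cstar_algebra) cstar_algebra_1 ..

definition emb :: "'a::cstar_algebra \<Rightarrow> 'a unitization" where
  "emb a = Unitization a 0"

lemma emb_parts [simp]: "vec_part (emb a) = a" "scalar_part (emb a) = 0"
  by (simp_all add: emb_def)

lemma emb_simps:
  "emb 0 = 0" "emb (a + b) = emb a + emb b" "emb (a - b) = emb a - emb b"
  "emb (- a) = - emb a" "emb (a * b) = emb a * emb b" "emb (r *\<^sub>R a) = r *\<^sub>R emb a"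
  "emb (adj a) = adj (emb a)"
  by (simp_all add: unitization_eq_iff)

lemma emb_eq_0_iff [simp]: "emb a = 0 \<longleftrightarrow> a = 0"
  by (simp add: unitization_eq_iff)

lemma norm_emb [simp]: "norm (emb a) = norm a"
proof (rule antisym)
  show "norm (emb a) \<le> norm a" using norm_unitization_le[of "emb a"] by simp
  show "norm a \<le> norm (emb a)"
    using norm_vec_part_le[of "emb a"] by (simp add: norm_unitization_def)
qed

text \<open>The algebra is an ideal of its unitization. Roots and negative parts are produced in the
  unitization; multiplication by \<open>emb x\<close> brings them back into the algebra.\<close>

lemma mult_emb: "u * emb x = emb (left_action u x)"
  by (simp add: unitization_eq_iff left_action_def)

lemma of_real_unitization [simp]:
  "vec_part (of_real r :: 'a::cstar_algebra unitization) = 0"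
  "scalar_part (of_real r :: 'a::cstar_algebra unitization) = of_real r"
  by (simp_all add: of_real_def)

lemma adj_emb_mult_of_real:
  "adj (emb w) * of_real r * emb w = emb (r *\<^sub>R (adj w * w))"
  by (simp add: of_real_def emb_simps)

section \<open>Order in an algebra without unit\<close>

definition nonneg :: "'a::cstar_algebra \<Rightarrow> bool" where
  "nonneg x \<longleftrightarrow> pos (emb x)"

lemma nonneg_selfadjoint: "nonneg x \<Longrightarrow> adj x = x"
  using pos_selfadjoint[of "emb x"] by (simp add: nonneg_def unitization_eq_iff)

lemma nonneg_adj_mult_self: "nonneg (adj x * x)"
  by (simp add: nonneg_def emb_simps pos_adj_mult_self)

lemma nonneg_0 [simp]: "nonneg 0"
  by (simp add: nonneg_def emb_simps)

lemma nonneg_add: "nonneg x \<Longrightarrow> nonneg y \<Longrightarrow> nonneg (x + y)"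
  by (simp add: nonneg_def emb_simps pos_add)

lemma nonneg_sum: "(\<And>i. i \<in> S \<Longrightarrow> nonneg (f i)) \<Longrightarrow> nonneg (sum f S)"
  by (induction S rule: infinite_finite_induct) (auto intro: nonneg_add)

lemma nonneg_scaleR: "nonneg x \<Longrightarrow> 0 \<le> r \<Longrightarrow> nonneg (r *\<^sub>R x)"
  by (simp add: nonneg_def emb_simps pos_scaleR)

lemma nonneg_conj: "nonneg x \<Longrightarrow> nonneg (adj z * x * z)"
  using pos_conj[of "emb x" "emb z"] by (simp add: nonneg_def emb_simps)

lemma nonneg_antisym: "nonneg x \<Longrightarrow> nonneg (- x) \<Longrightarrow> x = 0"
  using pos_antisym[of "emb x"] by (simp add: nonneg_def emb_simps)

lemma nonneg_norm_mono: "nonneg a \<Longrightarrow> nonneg (b - a) \<Longrightarrow> norm a \<le> norm b"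
  using pos_norm_mono[of "emb a" "emb b"] by (simp add: nonneg_def emb_simps)

text \<open>The inequality \<open>h \<le> \<parallel>h\<parallel>\<close> lives in the unitization,
  but its conjugate by \<open>w\<close> is one between elements of the algebra.\<close>

lemma nonneg_norm_bound:
  assumes "adj h = h"
  shows "nonneg (norm h *\<^sub>R (adj w * w) - adj w * h * w)"
proof -
  have "pos (of_real (norm h) - emb h)"
    using assms by (intro pos_of_real_diff) (auto simp: emb_simps[symmetric])
  from pos_conj[OF this, of "emb w"] show ?thesis
    by (simp add: nonneg_def right_diff_distrib left_diff_distrib adj_emb_mult_of_real emb_simps)
qed

lemma nonneg_mult_bound: "nonneg ((norm a)\<^sup>2 *\<^sub>R (adj w * w) - adj (a * w) * (a * w))"
  using nonneg_norm_bound[of "adj a * a" w] by (simp add: adj_simps cstar_identity mult.assoc)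

lemma norm_le_of_nonneg_both:
  assumes "nonneg w" "0 \<le> e" "nonneg (e *\<^sub>R w - x)" "nonneg (e *\<^sub>R w + x)"
  shows "norm x \<le> e * norm w"
proof -
  have "pos (of_real (e * norm w) - e *\<^sub>R emb w)"
    using assms by (intro pos_of_real_diff) (auto simp: emb_simps[symmetric] adj_scaleR nonneg_selfadjoint)
  with assms have "pos (of_real (e * norm w) - e *\<^sub>R emb w + (e *\<^sub>R emb w - emb x))"
    "pos (of_real (e * norm w) - e *\<^sub>R emb w + (e *\<^sub>R emb w + emb x))"
    unfolding nonneg_def emb_simps by (blast intro: pos_add)+
  then have "norm (emb x) \<le> e * norm w"
    by (intro norm_le_of_pos_both) simp_all
  then show ?thesis by simp
qed

lemma selfadjoint_cube_eq_0:
  fixes n :: "'a::cstar_algebra"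
  assumes "adj n = n" "n * n * n = 0" shows "n = 0"
proof -
  have "n * n * (n * n) = 0" using assms(2) by (simp add: mult.assoc[symmetric])
  then show ?thesis
    using assms(1) selfadjoint_square_eq_0[of "n * n"] selfadjoint_square_eq_0[of n]
    by (simp add: adj_mult)
qed

text \<open>The negative part \<open>n\<close> of \<open>x\<close> is found only in the unitization.
  Its square \<open>n\<^sup>2 = - n x\<close> lies in the algebra, and \<open>k = n\<^sup>2\<close>
  gives \<open>k x k = - n\<^sup>5\<close>, where \<open>n\<^sup>5\<close> is the conjugate of
  \<open>n\<^sup>3\<close> by \<open>n\<close>.\<close>

lemma nonneg_or_negative_compression:
  fixes x :: "'a::cstar_algebra"
  assumes "adj x = x" "\<not> nonneg x"
  obtains k where "adj k = k" "k * x * k \<noteq> 0" "nonneg (- (k * x * k))"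
proof -
  have "adj (emb x) = emb x" "\<not> pos (emb x)"
    using assms by (auto simp: nonneg_def emb_simps[symmetric])
  then obtain n where n: "adj n = n" "n \<noteq> 0" "n * emb x = - (n * n)" "emb x * n = - (n * n)"
    "pos (n * n * n)"
    by (rule negative_part)
  define k where "k = - left_action n x"
  have k: "emb k = n * n" using n(3) by (simp add: k_def emb_simps mult_emb[symmetric])
  have kxk: "emb (k * x * k) = - (n * (n * n * n) * n)"
    unfolding emb_simps k using n(3) by (simp add: mult.assoc)
  show ?thesis
  proof (rule that)
    have "emb (adj k) = emb k" using n(1) by (simp add: emb_simps k adj_mult)
    then show "adj k = k" by (simp add: unitization_eq_iff)
    show "nonneg (- (k * x * k))"
      using pos_conj[OF n(5), of n] kxk n(1) by (simp add: nonneg_def emb_simps(4))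
    show "k * x * k \<noteq> 0"
    proof
      assume "k * x * k = 0"
      then have "n * (n * n * n) * n = 0" using kxk by (simp add: emb_simps(1))
      then have "n * n * n * (n * n * n) = 0" by (simp add: mult.assoc[symmetric])
      then have "n * n * n = 0"
        using selfadjoint_square_eq_0[of "n * n * n"] n(1) by (simp add: adj_mult mult.assoc)
      with n(1,2) selfadjoint_cube_eq_0 show False by blast
    qed
  qed
qed

section \<open>Primeness\<close>

text \<open>Annihilators replace the closed ideals generated by \<open>a\<close> and
  \<open>b\<close>: \<open>I\<close> is the left annihilator of \<open>A b\<close> and
  \<open>J\<close> the right annihilator of \<open>I A\<close>. They are closed by continuity and
  contain \<open>a\<close> and \<open>b\<close>.\<close>

lemma prime_mult_nonzero:
  assumes prime: "prime_cstar_ideal ({0} :: 'a::cstar_algebra set)"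
    and "a \<noteq> 0" "b \<noteq> (0::'a)"
  obtains x where "a * x * b \<noteq> 0"
proof (rule ccontr)
  assume "\<not> thesis"
  with that have ab: "a * x * b = 0" for x by blast
  define I where "I = (\<Inter>z. {x. x * z * b = 0})"
  define J where "J = (\<Inter>x\<in>I. \<Inter>z. {y. x * z * y = 0})"
  have "closed I" "closed J"
    unfolding I_def J_def by (intro closed_INT ballI closed_Collect_eq continuous_intros)+
  have "cstar_ideal I"
    unfolding cstar_ideal_def
  proof (intro conjI ballI allI)
    fix x c
    assume x: "x \<in> I"
    show "c * x \<in> I" using x by (simp add: I_def mult.assoc)
    show "x * c \<in> I" using x by (simp add: I_def mult.assoc[of x c])
  qed (use \<open>closed I\<close> in \<open>auto simp: I_def distrib_right mult_scaleC_left\<close>)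
  moreover have "cstar_ideal J"
    unfolding cstar_ideal_def
  proof (intro conjI ballI allI)
    fix y c
    assume y: "y \<in> J"
    show "y * c \<in> J" using y by (simp add: J_def mult.assoc[symmetric])
    show "c * y \<in> J" using y by (simp add: J_def) (metis mult.assoc)
  qed (use \<open>closed J\<close> in \<open>auto simp: J_def distrib_left mult_scaleC_right\<close>)
  moreover have "\<forall>x\<in>I. \<forall>y\<in>J. x * y \<in> {0}"
  proof (intro ballI)
    fix x y assume "x \<in> I" "y \<in> J"
    \<comment> \<open>This middle factor gives \<open>t t\<^sup>* t = 0\<close> for
      \<open>t = x y\<close>, which forces \<open>t = 0\<close>.\<close>
    then have "x * (y * adj y * adj x * x) * y = 0" by (auto simp: J_def)
    then have "adj (x * y) * (x * y) * (adj (x * y) * (x * y)) = 0"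
      by (simp add: adj_mult mult.assoc)
    then have "adj (x * y) * (x * y) = 0"
      by (subst (asm) selfadjoint_square_eq_0) (auto simp: adj_simps mult.assoc)
    then show "x * y \<in> {0}" by simp
  qed
  ultimately have "I \<subseteq> {0} \<or> J \<subseteq> {0}"
    using prime unfolding prime_cstar_ideal_def by blast
  moreover have "a \<in> I" using ab by (simp add: I_def)
  moreover have "b \<in> J" by (auto simp: I_def J_def)
  ultimately show False using assms(2,3) by blast
qed

text \<open>The positive part \<open>n\<close> of \<open>a\<^sup>* a - r\<close> replaces the
  spectral projection of \<open>a\<^sup>* a\<close> above \<open>r\<close>: since
  \<open>n (a\<^sup>* a - r) n = n\<^sup>3 \<ge> 0\<close>, left multiplication by \<open>a\<close>
  shrinks elements of \<open>n A\<close> by at most the factor \<open>\<surd>r\<close>. The element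
  \<open>p\<close> is a nonzero \<open>n x\<close>.\<close>

lemma almost_norming_right_ideal:
  fixes a :: "'a::cstar_algebra"
  assumes "0 \<le> r" "r < (norm a)\<^sup>2"
  obtains p where "p \<noteq> 0" "\<And>w. r * (norm (p * w))\<^sup>2 \<le> (norm (a * (p * w)))\<^sup>2"
proof -
  define h where "h = emb (adj a * a)"
  have h: "adj h = h" "pos h" "norm h = (norm a)\<^sup>2"
    by (simp_all add: h_def emb_simps(5,7) adj_simps pos_adj_mult_self)
       (simp add: emb_simps(5,7)[symmetric] cstar_identity)
  have "\<not> pos (of_real r - h)"
    using norm_le_of_pos[OF h(2), of r] h(3) assms(2) by auto
  moreover have "adj (of_real r - h) = of_real r - h" by (simp add: adj_diff h)
  ultimately obtain n where n: "adj n = n" "n \<noteq> 0" "n * (of_real r - h) = - (n * n)" "pos (n * n * n)"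
    using negative_part by blast
  have nhn: "n * (h - of_real r) * n = n * n * n"
  proof -
    have "n * (h - of_real r) = n * n" using n(3) by (simp add: algebra_simps)
    then show ?thesis by simp
  qed
  have nhn': "n * ((h - of_real r) * (n * z)) = n * (n * (n * z))" for z
  proof -
    have "n * ((h - of_real r) * (n * z)) = n * (h - of_real r) * n * z" by (simp only: mult.assoc)
    also have "\<dots> = n * (n * (n * z))" by (simp only: nhn) (simp only: mult.assoc)
    finally show ?thesis .
  qed
  \<comment> \<open>If \<open>n\<close> annihilated the algebra, then \<open>n h = 0\<close>, and
    \<open>n\<^sup>3 = - r n\<^sup>2\<close> would be both positive and negative.\<close>
  have "\<exists>x. left_action n x \<noteq> 0"
  proof (rule ccontr)
    assume "\<not> ?thesis"
    then have "n * h = 0" by (simp add: h_def mult_emb emb_simps(1))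
    then have "n * n * n = - (r *\<^sub>R (n * n))"
      using nhn by (simp add: of_real_def right_diff_distrib)
    moreover have "pos (r *\<^sub>R (n * n))" by (intro pos_scaleR pos_square n assms)
    ultimately have "n * n * n = 0" using pos_antisym[OF n(4)] by simp
    with n(1,2) selfadjoint_cube_eq_0 show False by blast
  qed
  then obtain x where x: "left_action n x \<noteq> 0" by blast
  show ?thesis
  proof (rule that[OF x])
    fix w
    define y where "y = left_action n x * w"
    have y: "emb y = n * emb (x * w)"
      by (simp add: y_def emb_simps(5) mult_emb[symmetric] mult.assoc)
    have "pos (adj (emb (x * w)) * (n * n * n) * emb (x * w))" by (rule pos_conj[OF n(4)])
    also have "adj (emb (x * w)) * (n * n * n) * emb (x * w) =
        adj (emb y) * (h - of_real r) * emb y"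
      by (simp add: nhn' y adj_mult n(1) mult.assoc)
    also have "\<dots> = emb (adj (a * y) * (a * y) - r *\<^sub>R (adj y * y))"
      by (simp add: right_diff_distrib left_diff_distrib adj_emb_mult_of_real)
         (simp add: h_def emb_simps adj_mult mult.assoc)
    finally have "norm (r *\<^sub>R (adj y * y)) \<le> norm (adj (a * y) * (a * y))"
      by (intro nonneg_norm_mono nonneg_scaleR nonneg_adj_mult_self assms) (simp add: nonneg_def)
    then show "r * (norm y)\<^sup>2 \<le> (norm (a * y))\<^sup>2"
      using assms(1) by (simp add: cstar_identity)
  qed
qed

text \<open>Primeness gives a nonzero \<open>y\<close> in \<open>p A q\<^sup>*\<close>, where
  \<open>p\<close> makes \<open>a\<close> almost norming from the left and \<open>q\<close> makes
  \<open>b\<close> almost norming from the right. One such \<open>y\<close> bounds the product of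
  norms.\<close>

theorem prime_norm_mult_le:
  fixes a b :: "'a::cstar_algebra"
  assumes prime: "prime_cstar_ideal ({0} :: 'a set)"
    and K: "\<And>x. norm (a * x * b) \<le> K * norm x"
  shows "norm a * norm b \<le> K"
proof -
  have "r * s \<le> K\<^sup>2" if r: "0 \<le> r" "r < (norm a)\<^sup>2" and s: "0 \<le> s" "s < (norm b)\<^sup>2" for r s
  proof -
    obtain p where p: "p \<noteq> 0" "\<And>w. r * (norm (p * w))\<^sup>2 \<le> (norm (a * (p * w)))\<^sup>2"
      using almost_norming_right_ideal[OF r] by blast
    have "s < (norm (adj b))\<^sup>2" using s by simp
    then obtain q where q: "q \<noteq> 0" "\<And>w. s * (norm (q * w))\<^sup>2 \<le> (norm (adj b * (q * w)))\<^sup>2"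
      using almost_norming_right_ideal[OF s(1)] by blast
    \<comment> \<open>Adjoints turn the estimate for left multiplication by \<open>adj b\<close> on
      \<open>q A\<close> into one for right multiplication by \<open>b\<close> on
      \<open>A q\<^sup>*\<close>.\<close>
    have q': "s * (norm (w * adj q))\<^sup>2 \<le> (norm (w * adj q * b))\<^sup>2" for w
    proof -
      have "norm (q * adj w) = norm (w * adj q)" "norm (adj b * (q * adj w)) = norm (w * adj q * b)"
        using norm_adj[of "w * adj q"] norm_adj[of "w * adj q * b"] by (simp_all add: adj_simps)
      with q(2)[of "adj w"] show ?thesis by simp
    qed
    have "adj q \<noteq> 0" using q(1) by (metis adj_adj adj_zero)
    then obtain w where w: "p * w * adj q \<noteq> 0" using prime_mult_nonzero[OF prime p(1)] by blast
    let ?y = "p * w * adj q"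
    have "r * s * (norm ?y)\<^sup>2 = s * (r * (norm ?y)\<^sup>2)" by simp
    also have "\<dots> \<le> s * (norm (a * ?y))\<^sup>2"
      using p(2)[of "w * adj q"] s by (intro mult_left_mono) (simp_all add: mult.assoc)
    also have "\<dots> \<le> (norm (a * ?y * b))\<^sup>2" using q'[of "a * (p * w)"] by (simp add: mult.assoc)
    also have "\<dots> \<le> (K * norm ?y)\<^sup>2" by (intro power_mono K) simp
    finally show ?thesis using w by (simp add: power_mult_distrib)
  qed
  note * = this
  obtain x0 :: 'a where "x0 \<noteq> 0" using prime unfolding prime_cstar_ideal_def by blast
  have "0 \<le> K * norm x0" using order_trans[OF norm_ge_zero K[of x0]] .
  then have K0: "0 \<le> K" using \<open>x0 \<noteq> 0\<close> by (simp add: zero_le_mult_iff)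
  show ?thesis
  proof (cases "a = 0 \<or> b = 0")
    case False
    show ?thesis
    proof (rule field_le_mult_one_interval)
      fix t :: real assume t: "0 < t" "t < 1"
      have "(t * (norm a * norm b))\<^sup>2 = t * (norm a)\<^sup>2 * (t * (norm b)\<^sup>2)"
        by (simp add: power2_eq_square)
      also have "\<dots> \<le> K\<^sup>2" using t False by (intro *) auto
      finally show "t * (norm a * norm b) \<le> K" using K0 by (rule power2_le_imp_le)
    qed
  qed (use K0 in auto)
qed

section \<open>Excision\<close>

text \<open>Unlike a bound on \<open>\<parallel>y\<^sup>* (a - c) y\<parallel>\<close> relative to \<open>\<parallel>y\<parallel>\<^sup>2\<close>, these order bounds persist when \<open>y\<close> is
  multiplied on the right.\<close>

definition excises :: "real \<Rightarrow> 'a::cstar_algebra \<Rightarrow> 'a \<Rightarrow> real \<Rightarrow> bool" where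
  "excises e y a c \<longleftrightarrow> nonneg (adj y * a * y - (c - e) *\<^sub>R (adj y * y)) \<and>
     nonneg ((c + e) *\<^sub>R (adj y * y) - adj y * a * y)"

lemma excises_mult: "excises e y a c \<Longrightarrow> excises e (y * k) a c"
  unfolding excises_def
  by (elim conjE, drule (1) conjI[OF nonneg_conj[of _ k] nonneg_conj[of _ k]])
     (simp add: adj_mult right_diff_distrib left_diff_distrib mult.assoc)

lemma excises_norm_le:
  assumes "excises e y a c" "0 \<le> e"
  shows "norm (adj y * a * y - c *\<^sub>R (adj y * y)) \<le> e * (norm y)\<^sup>2"
proof -
  have "norm (adj y * a * y - c *\<^sub>R (adj y * y)) \<le> e * norm (adj y * y)"
    using assms unfolding excises_def
    by (intro norm_le_of_nonneg_both nonneg_adj_mult_self) (simp_all add: algebra_simps)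
  then show ?thesis by (simp add: cstar_identity)
qed

text \<open>\<open>c\<close> is the infimum of all \<open>m\<close> with \<open>(y k)\<^sup>* a (y k) \<le> m (y k)\<^sup>* (y k)\<close> for some \<open>k\<close>. If \<open>k\<close> almost attains
  it, then a negative part of \<open>(y k)\<^sup>* (a - (c - \<epsilon>)) (y k)\<close> would give an even smaller \<open>m\<close>.\<close>

lemma excision_step:
  fixes a y :: "'a::cstar_algebra"
  assumes a: "adj a = a" and "y \<noteq> 0" "0 < e"
  obtains k c where "y * k \<noteq> 0" "excises e (y * k) a c"
proof -
  define ub where "ub = (\<lambda>k m. nonneg (m *\<^sub>R (adj (y * k) * (y * k)) - adj (y * k) * a * (y * k)))"
  define M where "M = {m. \<exists>k. y * k \<noteq> 0 \<and> ub k m}"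
  have "ub (adj y) (norm a)" unfolding ub_def by (rule nonneg_norm_bound[OF a])
  moreover have "y * adj y \<noteq> 0" using assms by simp
  ultimately have ne: "M \<noteq> {}" unfolding M_def by blast
  have "- norm a \<le> m" if "m \<in> M" for m
  proof (rule ccontr)
    assume m: "\<not> - norm a \<le> m"
    from \<open>m \<in> M\<close> obtain k where k: "y * k \<noteq> 0" "ub k m" by (auto simp: M_def)
    let ?w = "adj (y * k) * (y * k)"
    have "nonneg (norm a *\<^sub>R ?w + adj (y * k) * a * (y * k))"
      using nonneg_norm_bound[of "- a" "y * k"] a by (simp add: adj_minus)
    from nonneg_add[OF this k(2)[unfolded ub_def]] have "nonneg ((norm a + m) *\<^sub>R ?w)"
      by (simp add: scaleR_left_distrib)
    moreover have "nonneg ((- (norm a + m)) *\<^sub>R ?w)"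
      using m by (intro nonneg_scaleR nonneg_adj_mult_self) simp
    ultimately have "(norm a + m) *\<^sub>R ?w = 0" by (intro nonneg_antisym) (simp_all only: scaleR_minus_left)
    then have "?w = 0" using m by simp
    with k(1) show False by simp
  qed
  then have bdd: "bdd_below M" by (auto simp: bdd_below_def)
  define c where "c = Inf M"
  obtain m where "m \<in> M" "m < c + e"
    using cInf_lessD[OF ne, of "c + e"] \<open>0 < e\<close> by (auto simp: c_def)
  then obtain k where k: "y * k \<noteq> 0" "ub k m" unfolding M_def by blast
  let ?z = "y * k"
  have upper: "nonneg ((c + e) *\<^sub>R (adj ?z * ?z) - adj ?z * a * ?z)"
  proof -
    have "nonneg ((c + e - m) *\<^sub>R (adj ?z * ?z))"
      using \<open>m < c + e\<close> by (intro nonneg_scaleR nonneg_adj_mult_self) simp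
    from nonneg_add[OF this k(2)[unfolded ub_def]] show ?thesis
      by (simp add: algebra_simps)
  qed
  have lower: "nonneg (adj ?z * a * ?z - (c - e) *\<^sub>R (adj ?z * ?z))"
  proof (rule ccontr)
    let ?x = "adj ?z * a * ?z - (c - e) *\<^sub>R (adj ?z * ?z)"
    assume "\<not> nonneg ?x"
    moreover have "adj ?x = ?x" by (simp add: adj_simps a mult.assoc)
    ultimately obtain l where l: "adj l = l" "l * ?x * l \<noteq> 0" "nonneg (- (l * ?x * l))"
      using nonneg_or_negative_compression by blast
    have eq: "l * ?x * l = adj (?z * l) * a * (?z * l) - (c - e) *\<^sub>R (adj (?z * l) * (?z * l))"
      using l(1) by (simp add: adj_mult right_diff_distrib left_diff_distrib mult.assoc)
    have "?z * l \<noteq> 0" using l(2) unfolding eq by auto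
    moreover have "ub (k * l) (c - e)"
      using l(3) unfolding eq ub_def by (simp add: mult.assoc)
    ultimately have "c - e \<in> M" by (auto simp: M_def mult.assoc)
    then have "c \<le> c - e" unfolding c_def by (rule cInf_lower[OF _ bdd])
    with \<open>0 < e\<close> show False by simp
  qed
  from that[OF k(1)] upper lower show ?thesis by (auto simp: excises_def)
qed

text \<open>Each new element is excised by passing from \<open>y\<close> to some \<open>y k\<close>,
  and \<open>excises_mult\<close> preserves what was achieved before.\<close>

lemma excision_finite:
  fixes F :: "'a::cstar_algebra set"
  assumes "finite F" "\<And>a. a \<in> F \<Longrightarrow> adj a = a" "0 < e" "\<exists>x::'a. x \<noteq> 0"
  shows "\<exists>y c. y \<noteq> 0 \<and> (\<forall>a\<in>F. excises e y a (c a))"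
  using assms(1,2)
proof (induction F)
  case empty
  then show ?case using assms(4) by simp
next
  case (insert b F)
  then obtain y c where y: "y \<noteq> 0" "\<forall>a\<in>F. excises e y a (c a)" by auto
  obtain k d where k: "y * k \<noteq> 0" "excises e (y * k) b d"
    using excision_step[of b y e] insert.prems y(1) assms(3) by auto
  have "\<forall>a\<in>insert b F. excises e (y * k) a ((c(b := d)) a)"
    using y(2) k(2) insert.hyps by (auto intro: excises_mult)
  with k(1) show ?case by blast
qed

text \<open>The elements \<open>y y\<^sup>*\<close> excise \<open>\<phi>\<close> in the sense of Akemann, Anderson and Pedersen; linearity of \<open>\<phi>\<close> is
  not needed.\<close>

definition excising :: "('a::cstar_algebra \<Rightarrow> complex) \<Rightarrow> bool" where
  "excising \<phi> \<longleftrightarrow> (\<forall>F e. finite F \<longrightarrow> 0 < e \<longrightarrow>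
     (\<exists>y. y \<noteq> 0 \<and> (\<forall>a\<in>F. norm (adj y * a * y - \<phi> a *\<^sub>C (adj y * y)) \<le> e * (norm y)\<^sup>2)))"

lemma excision_finite_complex:
  fixes F :: "'a::cstar_algebra set"
  assumes "finite F" "0 < e" "\<exists>x::'a. x \<noteq> 0"
  shows "\<exists>y \<phi>. y \<noteq> 0 \<and> (\<forall>a. cmod (\<phi> a) \<le> norm a + e) \<and>
    (\<forall>a\<in>F. norm (adj y * a * y - \<phi> a *\<^sub>C (adj y * y)) \<le> e * (norm y)\<^sup>2)"
proof -
  define h k where "h = (\<lambda>a::'a. (1/2) *\<^sub>R (a + adj a))"
    and "k = (\<lambda>a::'a. (1/2) *\<^sub>R (\<i> *\<^sub>C (adj a - a)))"
  have hk: "a = h a + \<i> *\<^sub>C k a" for a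
  proof -
    have "h a + \<i> *\<^sub>C k a = (1/2) *\<^sub>R (a + a)"
      by (simp add: h_def k_def scaleC_scaleR scaleC_scaleC scaleC_minus_left
          scaleR_right_distrib[symmetric])
    then show ?thesis by (simp add: scaleR_right_distrib scaleR_left_distrib[symmetric])
  qed
  have sa: "adj (h a) = h a" "adj (k a) = k a" for a
    by (simp_all add: h_def k_def adj_simps add.commute scaleC_diff_right scaleC_minus_left)
  have "\<And>a. a \<in> h ` F \<union> k ` F \<Longrightarrow> adj a = a" using sa by auto
  then obtain y c where y: "y \<noteq> 0" "\<forall>a\<in>h ` F \<union> k ` F. excises (e/2) y a (c a)"
    using excision_finite[of "h ` F \<union> k ` F" "e/2"] assms by (metis finite_UnI finite_imageI half_gt_zero)
  \<comment> \<open>The value \<open>0\<close> outside \<open>F\<close> makes the norm bound hold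
    everywhere, as the compactness argument requires.\<close>
  define \<phi> where "\<phi> = (\<lambda>a. if a \<in> F then of_real (c (h a)) + \<i> * of_real (c (k a)) else 0)"
  have le: "norm (adj y * a * y - \<phi> a *\<^sub>C (adj y * y)) \<le> e * (norm y)\<^sup>2" if "a \<in> F" for a
  proof -
    let ?d = "\<lambda>a. adj y * a * y - c a *\<^sub>R (adj y * y)"
    have d: "norm (?d (h a)) \<le> e/2 * (norm y)\<^sup>2" "norm (?d (k a)) \<le> e/2 * (norm y)\<^sup>2"
      using y(2) that assms(2) excises_norm_le[of "e/2" y "h a" "c (h a)"]
        excises_norm_le[of "e/2" y "k a" "c (k a)"] by simp_all
    have "adj y * a * y - \<phi> a *\<^sub>C (adj y * y) = ?d (h a) + \<i> *\<^sub>C ?d (k a)"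
      using that by (subst hk[of a]) (simp add: \<phi>_def algebra_simps mult_scaleC_left mult_scaleC_right
          scaleC_add_left scaleC_diff_right scaleC_scaleC scaleR_scaleC)
    then have "norm (adj y * a * y - \<phi> a *\<^sub>C (adj y * y)) \<le> norm (?d (h a)) + norm (?d (k a))"
      using norm_triangle_ineq[of "?d (h a)" "\<i> *\<^sub>C ?d (k a)"] by (simp add: norm_scaleC)
    with d show ?thesis by simp
  qed
  have bound: "cmod (\<phi> a) \<le> norm a + e" for a
  proof (cases "a \<in> F")
    case True
    have "norm (\<phi> a *\<^sub>C (adj y * y)) \<le> norm (adj y * a * y) + norm (adj y * a * y - \<phi> a *\<^sub>C (adj y * y))"
      by (metis norm_triangle_sub norm_minus_commute)
    also have "\<dots> \<le> norm (adj y) * norm a * norm y + e * (norm y)\<^sup>2"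
      by (intro add_mono le True order_trans[OF norm_mult_ineq] mult_right_mono norm_mult_ineq) simp
    finally have "cmod (\<phi> a) * (norm y)\<^sup>2 \<le> (norm a + e) * (norm y)\<^sup>2"
      by (simp add: norm_scaleC cstar_identity algebra_simps power2_eq_square)
    then show ?thesis using y(1) by simp
  qed (use assms(2) in \<open>simp add: \<phi>_def add_nonneg_nonneg\<close>)
  with y(1) le show ?thesis by blast
qed

text \<open>Tychonoff's theorem, for the topology of pointwise convergence.\<close>

lemma compact_function_box:
  fixes r :: "'i \<Rightarrow> real"
  shows "compact {f :: 'i \<Rightarrow> complex. \<forall>a. cmod (f a) \<le> r a}"
proof -
  have "compactin (product_topology (\<lambda>_. euclidean) UNIV) (PiE UNIV (\<lambda>a. cball (0::complex) (r a)))"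
    by (simp add: compactin_PiE)
  moreover have "PiE UNIV (\<lambda>a. cball (0::complex) (r a)) = {f. \<forall>a. cmod (f a) \<le> r a}" by auto
  ultimately show ?thesis by (simp add: euclidean_product_topology)
qed

text \<open>A common cluster point of the functions from \<open>excision_finite_complex\<close> as
  \<open>F\<close> grows and \<open>e\<close> shrinks. The sets \<open>C\<close> need not be closed,
  so their closures are intersected; a nearby function in \<open>C (F, e/2)\<close> then costs
  another \<open>e/2\<close> on the finite set \<open>F\<close>.\<close>

lemma exists_excising:
  assumes nz: "\<exists>x::'a::cstar_algebra. x \<noteq> 0"
  obtains \<phi> :: "'a::cstar_algebra \<Rightarrow> complex" where "excising \<phi>"
proof -
  define S where "S = {\<phi> :: 'a \<Rightarrow> complex. \<forall>a. cmod (\<phi> a) \<le> norm a + 1}"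
  define C where "C = (\<lambda>(F, e). {\<phi>::'a \<Rightarrow> complex. \<exists>y. y \<noteq> 0 \<and>
     (\<forall>a\<in>F. norm (adj y * a * y - \<phi> a *\<^sub>C (adj y * y)) \<le> e * (norm y)\<^sup>2)})"
  define I :: "('a set \<times> real) set" where "I = {(F, e). finite F \<and> 0 < e}"
  have mono: "C (F', e') \<subseteq> C (F, e)" if "F \<subseteq> F'" "e' \<le> e" for F F' e e'
    unfolding C_def using that
    by clarsimp (meson mult_right_mono order_trans subsetD zero_le_power2)
  have "S \<inter> (\<Inter>i\<in>I. closure (C i)) \<noteq> {}"
  proof (rule compact_imp_fip_image)
    show "compact S" unfolding S_def by (rule compact_function_box)
    fix I' assume I': "finite I'" "I' \<subseteq> I"
    \<comment> \<open>The inserted \<open>1\<close> keeps \<open>e0\<close> at most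
      \<open>1\<close>, so that the function stays in the fixed box \<open>S\<close>; it also covers
      empty \<open>I'\<close>.\<close>
    define F0 e0 where "F0 = \<Union>(fst ` I')" and "e0 = Min (insert 1 (snd ` I'))"
    have "finite F0" using I' by (auto simp: F0_def I_def)
    moreover have "0 < e0" using I' by (auto simp: e0_def I_def)
    ultimately obtain y \<phi> where y: "y \<noteq> 0" "\<forall>a. cmod (\<phi> a) \<le> norm a + e0"
      "\<forall>a\<in>F0. norm (adj y * a * y - \<phi> a *\<^sub>C (adj y * y)) \<le> e0 * (norm y)\<^sup>2"
      using excision_finite_complex[OF _ _ nz, of F0 e0] by blast
    have "e0 \<le> 1" using I' by (simp add: e0_def)
    have "cmod (\<phi> a) \<le> norm a + 1" for a
      using y(2)[rule_format, of a] \<open>e0 \<le> 1\<close> by linarith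
    then have "\<phi> \<in> S" by (simp add: S_def)
    moreover have "\<phi> \<in> C i" if "i \<in> I'" for i
    proof -
      have "fst i \<subseteq> F0" "e0 \<le> snd i" using that I' by (auto simp: F0_def e0_def)
      moreover have "\<phi> \<in> C (F0, e0)" using y(1,3) by (auto simp: C_def)
      ultimately show ?thesis using mono[of "fst i" F0 e0 "snd i"] by auto
    qed
    ultimately show "S \<inter> (\<Inter>i\<in>I'. closure (C i)) \<noteq> {}"
      using closure_subset by blast
  qed auto
  then obtain \<phi> where \<phi>: "\<And>i. i \<in> I \<Longrightarrow> \<phi> \<in> closure (C i)" by blast
  have "excising \<phi>"
    unfolding excising_def
  proof (intro allI impI)
    fix F :: "'a set" and e :: real
    assume F: "finite F" "0 < e"
    define U where "U = (\<Inter>a\<in>F. {\<psi>::'a \<Rightarrow> complex. cmod (\<psi> a - \<phi> a) < e/2})"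
    have "open U"
      unfolding U_def using F(1) by (intro open_INT ballI open_Collect_less continuous_intros) auto
    moreover have "\<phi> \<in> U" using F(2) by (simp add: U_def)
    moreover have "\<phi> \<in> closure (C (F, e/2))" using F by (intro \<phi>) (simp add: I_def)
    ultimately obtain \<psi> where \<psi>: "\<psi> \<in> U" "\<psi> \<in> C (F, e/2)"
      by (metis open_Int_closure_eq_empty disjoint_iff)
    then obtain y where y: "y \<noteq> 0"
      "\<And>a. a \<in> F \<Longrightarrow> norm (adj y * a * y - \<psi> a *\<^sub>C (adj y * y)) \<le> e/2 * (norm y)\<^sup>2"
      by (auto simp: C_def)
    have "norm (adj y * a * y - \<phi> a *\<^sub>C (adj y * y)) \<le> e * (norm y)\<^sup>2" if a: "a \<in> F" for a
    proof -
      have "adj y * a * y - \<phi> a *\<^sub>C (adj y * y) =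
          (adj y * a * y - \<psi> a *\<^sub>C (adj y * y)) + (\<psi> a - \<phi> a) *\<^sub>C (adj y * y)"
        by (simp add: scaleC_diff_left)
      then have "norm (adj y * a * y - \<phi> a *\<^sub>C (adj y * y)) \<le>
          norm (adj y * a * y - \<psi> a *\<^sub>C (adj y * y)) + norm ((\<psi> a - \<phi> a) *\<^sub>C (adj y * y))"
        by (metis norm_triangle_ineq)
      also have "\<dots> \<le> e/2 * (norm y)\<^sup>2 + cmod (\<psi> a - \<phi> a) * (norm y)\<^sup>2"
        using y(2)[OF a] by (simp add: norm_scaleC cstar_identity)
      also have "\<dots> \<le> e/2 * (norm y)\<^sup>2 + e/2 * (norm y)\<^sup>2"
        using \<psi>(1) a by (intro add_left_mono mult_right_mono) (auto simp: U_def less_imp_le)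
      finally show ?thesis by simp
    qed
    with y(1) show "\<exists>y. y \<noteq> 0 \<and> (\<forall>a\<in>F. norm (adj y * a * y - \<phi> a *\<^sub>C (adj y * y)) \<le> e * (norm y)\<^sup>2)"
      by blast
  qed
  with that show ?thesis by blast
qed

text \<open>In the unitization, \<open>q = \<Sum> a a\<^sup>*\<close> lies in a proper ideal, so \<open>q - e\<^sup>2\<close> has a negative part \<open>n \<noteq> 0\<close>;
  if left multiplication by \<open>n\<close> vanished on the algebra, then the algebra would have a unit.\<close>

lemma excising_zero:
  assumes nonunital: "\<nexists>u::'a::cstar_algebra. \<forall>x. u * x = x \<and> x * u = x"
  shows "excising (\<lambda>a::'a. 0)"
  unfolding excising_def
proof (intro allI impI)
  fix F :: "'a set" and e :: real
  assume F: "finite F" "0 < e"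
  define q where "q = (\<Sum>a\<in>F. a * adj a)"
  define r where "r = e\<^sup>2"
  define x where "x = emb q - of_real r"
  have "adj q = q" by (simp add: q_def adj_sum adj_simps)
  then have sa: "adj x = x" by (simp add: x_def adj_diff emb_simps(7)[symmetric])
  \<comment> \<open>The scalar part is a character; it would send a positive root of
    \<open>x\<close> to a real number with square \<open>- r < 0\<close>.\<close>
  have np: "\<not> pos x"
  proof
    assume "pos x"
    then obtain d where d: "pos d" "d * d = x" using pos_sqrt by blast
    have "cnj (scalar_part d) = scalar_part d"
      using pos_selfadjoint[OF d(1)] by (metis unitization_parts'(4))
    then obtain s where "scalar_part d = of_real s" by (metis Reals_cases Reals_cnj_iff)
    moreover have "scalar_part d * scalar_part d = - of_real r"
      using arg_cong[OF d(2), of scalar_part] by (simp add: x_def)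
    ultimately have "complex_of_real (s * s) = of_real (- r)" by simp
    then have "s * s = - r" by (simp only: of_real_eq_iff)
    moreover have "0 \<le> s * s" by simp
    ultimately show False using F(2) by (simp add: r_def)
  qed
  obtain n where n: "adj n = n" "n \<noteq> 0" "n * x = - (n * n)" "x * n = - (n * n)"
    "pos (n * n * n)"
    by (rule negative_part[OF sa np])
  have "\<exists>z. left_action n z \<noteq> 0"
  proof (rule ccontr)
    assume "\<not> ?thesis"
    then have z: "vec_part n * z + scalar_part n *\<^sub>C z = 0" for z by (simp add: left_action_def)
    show False
    proof (cases "scalar_part n = 0")
      case True
      with z[of "adj (vec_part n)"] n(2) show False by (simp add: unitization_eq_iff)
    next
      case False
      \<comment> \<open>With this \<open>u\<close>, vanishing of \<open>n z\<close> for all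
        \<open>z\<close> says that \<open>u\<close> is a left unit; its adjoint is a right unit, and
        the two coincide.\<close>
      define u where "u = (- (1 / scalar_part n)) *\<^sub>C vec_part n"
      have u: "u * z = z" for z
      proof -
        have "u * z = (- (1 / scalar_part n)) *\<^sub>C (- (scalar_part n *\<^sub>C z))"
          using z[of z] by (simp add: u_def mult_scaleC_left add_eq_0_iff2)
        then show ?thesis using False by (simp add: scaleC_minus_left scaleC_minus_right scaleC_scaleC)
      qed
      have u': "z * adj u = z" for z using u[of "adj z"] by (metis adj_adj adj_mult)
      have "u = adj u" using u[of "adj u"] u'[of u] by simp
      with u u' have "\<forall>z. u * z = z \<and> z * u = z" by metis
      with nonunital show False by blast
    qed
  qed
  then obtain z where z: "left_action n z \<noteq> 0" by blast
  define y where "y = left_action n z"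
  have y: "emb y = n * emb z" by (simp add: y_def mult_emb)
  have nxn: "n * (x * (n * v)) = - (n * (n * (n * v)))" for v
  proof -
    have "n * (x * (n * v)) = (n * x) * (n * v)" by (simp only: mult.assoc)
    then show ?thesis using n(3) by (simp add: mult.assoc)
  qed
  have "pos (adj (emb z) * (n * n * n) * emb z)" by (rule pos_conj[OF n(5)])
  also have "adj (emb z) * (n * n * n) * emb z = adj (emb y) * (of_real r - emb q) * emb y"
  proof -
    have "of_real r - emb q = - x" by (simp add: x_def)
    then show ?thesis by (simp add: y adj_mult n(1) mult.assoc nxn)
  qed
  also have "\<dots> = emb (r *\<^sub>R (adj y * y) - adj y * q * y)"
    unfolding right_diff_distrib left_diff_distrib adj_emb_mult_of_real by (simp add: emb_simps)
  finally have upper: "nonneg (r *\<^sub>R (adj y * y) - adj y * q * y)" by (simp add: nonneg_def)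
  have "norm (adj y * a * y) \<le> e * (norm y)\<^sup>2" if a: "a \<in> F" for a
  proof -
    \<comment> \<open>Dropping the other summands of \<open>q\<close> gives \<open>y\<^sup>* a
      a\<^sup>* y \<le> y\<^sup>* q y \<le> e\<^sup>2 y\<^sup>* y\<close>; summing over
      \<open>F\<close> lets one \<open>y\<close> serve all its elements.\<close>
    have "norm (adj (adj a * y) * (adj a * y)) \<le> norm (r *\<^sub>R (adj y * y))"
    proof (intro nonneg_norm_mono nonneg_adj_mult_self)
      have "adj y * q * y - adj (adj a * y) * (adj a * y) = (\<Sum>b\<in>F - {a}. adj (adj b * y) * (adj b * y))"
        using F(1) a by (simp add: q_def sum.remove sum_distrib_left sum_distrib_right adj_simps
            distrib_left distrib_right mult.assoc)
      also have "nonneg \<dots>" by (intro nonneg_sum nonneg_adj_mult_self)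
      finally have "nonneg (adj y * q * y - adj (adj a * y) * (adj a * y))" .
      from nonneg_add[OF upper this]
      show "nonneg (r *\<^sub>R (adj y * y) - adj (adj a * y) * (adj a * y))" by simp
    qed
    then have "(norm (adj a * y))\<^sup>2 \<le> (e * norm y)\<^sup>2"
      by (simp add: cstar_identity power_mult_distrib r_def)
    then have "norm (adj a * y) \<le> e * norm y"
      by (rule power2_le_imp_le) (use F(2) in simp)
    moreover have "norm (adj y * a) = norm (adj a * y)"
      using norm_adj[of "adj y * a"] by (simp add: adj_simps)
    ultimately have "norm (adj y * a) * norm y \<le> e * norm y * norm y"
      by (intro mult_right_mono) auto
    then show ?thesis using norm_mult_ineq[of "adj y * a" y] by (simp add: power2_eq_square)
  qed
  then show "\<exists>y::'a. y \<noteq> 0 \<and> (\<forall>a\<in>F. norm (adj y * a * y - 0 *\<^sub>C (adj y * y)) \<le> e * (norm y)\<^sup>2)"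
    using z by (intro exI[of _ y]) (simp add: y_def)
qed

section \<open>Slices of elementary operators\<close>

lemma slice_le:
  fixes d :: "'a::cstar_algebra"
  assumes prime: "prime_cstar_ideal ({0} :: 'a set)" and "excising \<phi>"
    and K: "\<And>x. norm ((\<Sum>(a, b)\<leftarrow>l. a * x * b) - x * d) \<le> K * norm x"
  shows "norm ((\<Sum>(a, b)\<leftarrow>l. \<phi> a *\<^sub>C b) - d) \<le> K"
proof -
  define C where "C = (\<Sum>(a, b)\<leftarrow>l. norm b)"
  have C: "0 \<le> C" unfolding C_def by (rule sum_list_nonneg) auto
  let ?s = "\<Sum>(a, b)\<leftarrow>l. \<phi> a *\<^sub>C b"
  have le: "norm (?s - d) \<le> K + e * C" if "0 < e" for e
  proof -
    obtain y where y: "y \<noteq> 0"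
      "\<And>a. a \<in> fst ` set l \<Longrightarrow> norm (adj y * a * y - \<phi> a *\<^sub>C (adj y * y)) \<le> e * (norm y)\<^sup>2"
      using \<open>excising \<phi>\<close> \<open>0 < e\<close> unfolding excising_def by (metis List.finite_set finite_imageI)
    have slice: "norm (adj y * (\<Sum>(a, b)\<leftarrow>l. a * (y * x) * b) - adj y * y * x * ?s)
        \<le> e * (norm y)\<^sup>2 * norm x * C" for x
      unfolding C_def using y(2)
    proof (induction l)
      case (Cons p l)
      obtain a b where p: "p = (a, b)" by (cases p)
      let ?r = "adj y * (\<Sum>(a, b)\<leftarrow>l. a * (y * x) * b) - adj y * y * x * (\<Sum>(a, b)\<leftarrow>l. \<phi> a *\<^sub>C b)"
      let ?t = "adj y * a * y - \<phi> a *\<^sub>C (adj y * y)"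
      have "norm (?t * x * b) \<le> norm ?t * norm x * norm b"
        by (intro order_trans[OF norm_mult_ineq] mult_right_mono norm_mult_ineq) simp
      also have "\<dots> \<le> e * (norm y)\<^sup>2 * norm x * norm b"
        using Cons.prems p by (intro mult_right_mono) auto
      finally have "norm (?t * x * b + ?r) \<le> e * (norm y)\<^sup>2 * norm x * norm b
          + e * (norm y)\<^sup>2 * norm x * (\<Sum>(a, b)\<leftarrow>l. norm b)"
        using Cons by (intro norm_triangle_le add_mono) auto
      then show ?case
        by (simp add: p algebra_simps mult_scaleC_left mult_scaleC_right)
    qed simp
    \<comment> \<open>\<open>y\<^sup>* E(y x)\<close> is close to \<open>y\<^sup>* y x s\<close> by
      excision and to \<open>y\<^sup>* y x d\<close> by hypothesis. Both errors carry the factor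
      \<open>\<parallel>y\<parallel>\<^sup>2 = \<parallel>y\<^sup>* y\<parallel>\<close>, which
      cancels after \<open>prime_norm_mult_le\<close>, so \<open>K\<close> survives
      unchanged.\<close>
    have "norm (adj y * y * x * (?s - d)) \<le> (norm y)\<^sup>2 * (K + e * C) * norm x" for x
    proof -
      let ?E = "\<Sum>(a, b)\<leftarrow>l. a * (y * x) * b"
      have "adj y * y * x * (?s - d) = - (adj y * ?E - adj y * y * x * ?s) + adj y * (?E - y * x * d)"
        by (simp add: algebra_simps)
      also have "norm \<dots> \<le> e * (norm y)\<^sup>2 * norm x * C + norm (adj y) * (K * (norm y * norm x))"
      proof (intro norm_triangle_le add_mono order_trans[OF norm_mult_ineq] mult_left_mono)
        have "0 \<le> K * norm y"
          using order_trans[OF norm_ge_zero K[of y]] .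
        then have "0 \<le> K" using y(1) by (simp add: zero_le_mult_iff)
        then show "norm (?E - y * x * d) \<le> K * (norm y * norm x)"
          by (intro order_trans[OF K] mult_left_mono norm_mult_ineq)
      qed (use slice in \<open>auto simp: norm_minus_commute\<close>)
      finally show ?thesis by (simp add: algebra_simps power2_eq_square)
    qed
    from prime_norm_mult_le[OF prime this]
    have "(norm y)\<^sup>2 * norm (?s - d) \<le> (norm y)\<^sup>2 * (K + e * C)" by (simp add: cstar_identity)
    then show ?thesis using y(1) by simp
  qed
  show ?thesis
  proof (rule field_le_epsilon)
    fix e :: real assume "0 < e"
    \<comment> \<open>\<open>C + 1\<close> rather than \<open>C\<close>, since \<open>C = 0\<close>
      is possible.\<close>
    then have "e / (C + 1) * C \<le> e" using C by (simp add: field_simps)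
    with le[of "e / (C + 1)"] C \<open>0 < e\<close> show "norm (?s - d) \<le> K + e" by simp
  qed
qed

theorem derivation_limit_of_elementary:
  fixes \<delta> :: "'a::cstar_algebra \<Rightarrow> 'a"
  assumes prime: "prime_cstar_ideal ({0} :: 'a set)" and \<phi>: "excising \<phi>" and \<delta>: "\<delta> \<in> Der"
    and le: "\<And>n x. norm ((\<Sum>(a, b)\<leftarrow>l n. a * x * b) - \<delta> x) \<le> \<epsilon> n * norm x"
    and \<epsilon>: "\<epsilon> \<longlonglongrightarrow> 0"
  shows "\<exists>b. (\<lambda>n. \<Sum>(a, b)\<leftarrow>l n. \<phi> a *\<^sub>C b) \<longlonglongrightarrow> b \<and> (\<forall>y. \<delta> y = y * b - b * y)"
proof -
  define B where "B = (\<lambda>n. \<Sum>(a, b)\<leftarrow>l n. \<phi> a *\<^sub>C b)"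
  have mult: "\<delta> (x * y) = \<delta> x * y + x * \<delta> y" for x y using \<delta> by (simp add: Der_def)
  have commutator: "norm ((y * B n - B n * y) - \<delta> y) \<le> 2 * \<epsilon> n * norm y" for n y
  proof -
    \<comment> \<open>For the elementary operator \<open>E\<close> of \<open>l n\<close> this list
      represents \<open>x \<mapsto> E(x y) - E(x) y\<close>. The Leibniz rule gives
      \<open>\<delta>(x y) - \<delta>(x) y = x \<delta>(y)\<close>, hence the choice
      \<open>d = \<delta> y\<close>; the \<open>2\<close> counts the two approximation
      errors.\<close>
    let ?m = "map (\<lambda>(a, b). (a, y * b - b * y)) (l n)"
    have "(\<Sum>(a, b)\<leftarrow>map (\<lambda>(a, b). (a, y * b - b * y)) k. \<phi> a *\<^sub>C b) =
        y * (\<Sum>(a, b)\<leftarrow>k. \<phi> a *\<^sub>C b) - (\<Sum>(a, b)\<leftarrow>k. \<phi> a *\<^sub>C b) * y" for k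
      by (induction k) (auto simp: algebra_simps scaleC_diff_right mult_scaleC_left mult_scaleC_right)
    then have 1: "(\<Sum>(a, b)\<leftarrow>?m. \<phi> a *\<^sub>C b) = y * B n - B n * y" unfolding B_def .
    have "norm ((\<Sum>(a, b)\<leftarrow>?m. a * x * b) - x * \<delta> y) \<le> 2 * \<epsilon> n * norm y * norm x" for x
    proof -
      let ?E = "\<lambda>x. \<Sum>(a, b)\<leftarrow>l n. a * x * b"
      have "(\<Sum>(a, b)\<leftarrow>map (\<lambda>(a, b). (a, y * b - b * y)) k. a * x * b) =
          (\<Sum>(a, b)\<leftarrow>k. a * (x * y) * b) - (\<Sum>(a, b)\<leftarrow>k. a * x * b) * y" for k
        by (induction k) (auto simp: algebra_simps)
      then have "(\<Sum>(a, b)\<leftarrow>?m. a * x * b) - x * \<delta> y = (?E (x * y) - \<delta> (x * y)) - (?E x - \<delta> x) * y"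
        by (simp add: mult algebra_simps)
      also have "norm \<dots> \<le> \<epsilon> n * norm (x * y) + \<epsilon> n * norm x * norm y"
        by (intro norm_triangle_le_diff add_mono le order_trans[OF norm_mult_ineq] mult_right_mono) simp
      also have "\<dots> \<le> \<epsilon> n * (norm x * norm y) + \<epsilon> n * norm x * norm y"
      proof -
        \<comment> \<open>The sign of \<open>\<epsilon> n\<close> is extracted from
          \<open>le\<close> itself, which forces it wherever the norm is nonzero.\<close>
        have "0 \<le> \<epsilon> n \<or> norm (x * y) = 0"
          using order_trans[OF norm_ge_zero le[of "x * y" n]] by (auto simp: zero_le_mult_iff)
        moreover have "0 \<le> \<epsilon> n \<or> norm x = 0"
          using order_trans[OF norm_ge_zero le[of x n]] by (auto simp: zero_le_mult_iff)
        ultimately show ?thesis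
          using mult_left_mono[OF norm_mult_ineq[of x y], of "\<epsilon> n"] by (auto simp: algebra_simps)
      qed
      finally show ?thesis by (simp add: algebra_simps)
    qed
    from slice_le[OF prime \<phi> this] show ?thesis unfolding 1 .
  qed
  have diff: "norm (B m - B n) \<le> \<epsilon> m + \<epsilon> n" for m n
  proof -
    \<comment> \<open>The sign is put on the second component, in which the slice is linear by
      construction; \<open>\<phi>\<close> may fail to be odd.\<close>
    let ?m = "l m @ map (\<lambda>(a, b). (a, - b)) (l n)"
    have 1: "(\<Sum>(a, b)\<leftarrow>map (\<lambda>(a, b). (a, - b)) k. f a b) = - (\<Sum>(a, b)\<leftarrow>k. f a b)"
      if "\<And>a b. f a (- b) = - f a b" for f :: "'a \<Rightarrow> 'a \<Rightarrow> 'a" and k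
      using that by (induction k) auto
    have "norm ((\<Sum>(a, b)\<leftarrow>?m. a * x * b) - x * 0) \<le> (\<epsilon> m + \<epsilon> n) * norm x" for x
    proof -
      have "(\<Sum>(a, b)\<leftarrow>?m. a * x * b) - x * 0 =
          ((\<Sum>(a, b)\<leftarrow>l m. a * x * b) - \<delta> x) - ((\<Sum>(a, b)\<leftarrow>l n. a * x * b) - \<delta> x)"
        using 1[of "\<lambda>a b. a * x * b" "l n"] by (simp del: map_map)
      also have "norm \<dots> \<le> \<epsilon> m * norm x + \<epsilon> n * norm x"
        by (intro norm_triangle_le_diff add_mono le)
      finally show ?thesis by (simp add: distrib_right)
    qed
    from slice_le[OF prime \<phi> this] show ?thesis
      using 1[of "\<lambda>a b. \<phi> a *\<^sub>C b" "l n"] by (simp add: B_def scaleC_minus_right del: map_map)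
  qed
  have "Cauchy B"
  proof (rule CauchyI)
    fix e :: real assume "0 < e"
    then obtain M where M: "\<And>n. M \<le> n \<Longrightarrow> \<bar>\<epsilon> n\<bar> < e / 2"
      using LIMSEQ_D[OF \<epsilon>, of "e / 2"] by auto
    have "norm (B m - B n) < e" if "M \<le> m" "M \<le> n" for m n
      using diff[of m n] M[OF that(1)] M[OF that(2)] by linarith
    then show "\<exists>M. \<forall>m\<ge>M. \<forall>n\<ge>M. norm (B m - B n) < e" by blast
  qed
  then obtain b where b: "B \<longlonglongrightarrow> b" using Cauchy_convergent convergent_def by blast
  have "\<delta> y = y * b - b * y" for y
  proof -
    have "(\<lambda>n. 2 * \<epsilon> n * norm y) \<longlonglongrightarrow> 0" using tendsto_mult_left_zero tendsto_mult_right_zero \<epsilon> by blast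
    then have "(\<lambda>n. (y * B n - B n * y) - \<delta> y) \<longlonglongrightarrow> 0"
      by (rule Lim_null_comparison[OF always_eventually, rotated]) (simp add: commutator)
    then have "(\<lambda>n. y * B n - B n * y) \<longlonglongrightarrow> \<delta> y" by (rule LIM_zero_cancel)
    moreover have "(\<lambda>n. y * B n - B n * y) \<longlonglongrightarrow> y * b - b * y" by (intro tendsto_intros b)
    ultimately show ?thesis by (rule LIMSEQ_unique)
  qed
  with b show ?thesis unfolding B_def by blast
qed

section \<open>Completely bounded maps\<close>

definition apply_matrix :: "nat \<Rightarrow> (nat \<Rightarrow> nat \<Rightarrow> 'a::cstar_algebra) \<Rightarrow> (nat \<Rightarrow> 'a) \<Rightarrow> nat \<Rightarrow> 'a" where
  "apply_matrix n X v = (\<lambda>i. \<Sum>j<n. X i j * v j)"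

lemma matrix_norm_eq:
  "matrix_norm n X = Sup {column_norm n (apply_matrix n X v) | v. column_norm n v \<le> 1}"
  by (simp add: matrix_norm_def apply_matrix_def)

lemma column_norm_nonneg [simp]: "0 \<le> column_norm n v"
  by (simp add: column_norm_def)

lemma column_norm_sq: "(column_norm n v)\<^sup>2 = norm (\<Sum>i<n. adj (v i) * v i)"
  by (simp add: column_norm_def)

lemma column_norm_zero [simp]: "column_norm n (\<lambda>i. 0) = 0"
  by (simp add: column_norm_def)

lemma nonneg_column: "nonneg (\<Sum>i<n. adj (v i) * v i)"
  by (intro nonneg_sum nonneg_adj_mult_self)

lemma norm_component_le_column_norm:
  assumes "i < n" shows "norm (v i) \<le> column_norm n v"
proof -
  have "norm (adj (v i) * v i) \<le> norm (\<Sum>i<n. adj (v i) * v i)"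
  proof (intro nonneg_norm_mono nonneg_adj_mult_self)
    have "(\<Sum>i<n. adj (v i) * v i) - adj (v i) * v i = (\<Sum>i\<in>{..<n} - {i}. adj (v i) * v i)"
      using assms by (simp add: sum.remove)
    then show "nonneg ((\<Sum>i<n. adj (v i) * v i) - adj (v i) * v i)"
      by (simp add: nonneg_sum nonneg_adj_mult_self)
  qed
  then have "(norm (v i))\<^sup>2 \<le> (column_norm n v)\<^sup>2"
    by (simp add: column_norm_sq cstar_identity)
  then show ?thesis by (rule power2_le_imp_le) simp
qed

lemma column_norm_mult_le: "column_norm n (\<lambda>i. a * v i) \<le> norm a * column_norm n v"
proof -
  have "norm (\<Sum>i<n. adj (a * v i) * (a * v i)) \<le> norm ((norm a)\<^sup>2 *\<^sub>R (\<Sum>i<n. adj (v i) * v i))"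
  proof (intro nonneg_norm_mono nonneg_column)
    show "nonneg ((norm a)\<^sup>2 *\<^sub>R (\<Sum>i<n. adj (v i) * v i) - (\<Sum>i<n. adj (a * v i) * (a * v i)))"
      unfolding scaleR_sum_right sum_subtractf[symmetric] by (intro nonneg_sum nonneg_mult_bound)
  qed
  then have "(column_norm n (\<lambda>i. a * v i))\<^sup>2 \<le> (norm a * column_norm n v)\<^sup>2"
    by (simp add: column_norm_sq power_mult_distrib)
  then show ?thesis by (rule power2_le_imp_le) simp
qed

lemma column_norm_scaleR: "column_norm n (\<lambda>i. r *\<^sub>R v i) = \<bar>r\<bar> * column_norm n v"
proof -
  have "(\<Sum>i<n. adj (r *\<^sub>R v i) * (r *\<^sub>R v i)) = (r * r) *\<^sub>R (\<Sum>i<n. adj (v i) * v i)"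
    by (simp add: adj_scaleR scaleR_sum_right)
  then show ?thesis
    by (simp add: column_norm_def real_sqrt_mult abs_mult)
qed

text \<open>The factor \<open>2\<close> comes from using the parallelogram law in place of the Cauchy-Schwarz
  inequality.\<close>

lemma column_norm_add_le:
  fixes v w :: "nat \<Rightarrow> 'a::cstar_algebra"
  shows "column_norm n (\<lambda>i. v i + w i) \<le> 2 * (column_norm n v + column_norm n w)"
proof -
  let ?s = "\<lambda>v. \<Sum>i<n. adj (v i) * v i :: 'a"
  have "norm (?s (\<lambda>i. v i + w i)) \<le> norm (2 *\<^sub>R ?s v + 2 *\<^sub>R ?s w)"
  proof (intro nonneg_norm_mono nonneg_column)
    have "2 *\<^sub>R ?s v + 2 *\<^sub>R ?s w - ?s (\<lambda>i. v i + w i) = ?s (\<lambda>i. v i - w i)"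
      by (simp add: scaleR_sum_right sum.distrib[symmetric] sum_subtractf[symmetric])
         (rule sum.cong, auto simp: adj_simps algebra_simps scaleR_2)
    then show "nonneg (2 *\<^sub>R ?s v + 2 *\<^sub>R ?s w - ?s (\<lambda>i. v i + w i))"
      using nonneg_column by simp
  qed
  also have "\<dots> \<le> 2 * (column_norm n v)\<^sup>2 + 2 * (column_norm n w)\<^sup>2"
    by (rule norm_triangle_le) (simp add: column_norm_sq)
  also have "\<dots> \<le> (2 * (column_norm n v + column_norm n w))\<^sup>2"
    by (simp add: power2_eq_square algebra_simps)
  finally have "(column_norm n (\<lambda>i. v i + w i))\<^sup>2 \<le> (2 * (column_norm n v + column_norm n w))\<^sup>2"
    by (simp add: column_norm_sq)
  then show ?thesis by (rule power2_le_imp_le) simp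
qed

text \<open>A crude entrywise bound, enough to make the \<open>Sup\<close> in
  \<open>matrix_norm\<close> a genuine supremum.\<close>

lemma apply_matrix_bounded:
  fixes X :: "nat \<Rightarrow> nat \<Rightarrow> 'a::cstar_algebra"
  shows "\<exists>K. \<forall>v. column_norm n v \<le> 1 \<longrightarrow> column_norm n (apply_matrix n X v) \<le> K"
proof (intro exI allI impI)
  fix v :: "nat \<Rightarrow> 'a" assume v: "column_norm n v \<le> 1"
  have comp: "norm (apply_matrix n X v i) \<le> (\<Sum>j<n. norm (X i j))" for i
    unfolding apply_matrix_def
  proof (rule sum_norm_le)
    fix j assume "j \<in> {..<n}"
    then have "norm (v j) \<le> 1" using norm_component_le_column_norm[of j n v] v by simp
    then show "norm (X i j * v j) \<le> norm (X i j)"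
      using norm_mult_ineq[of "X i j" "v j"] by (meson mult_left_le norm_ge_zero order_trans)
  qed
  have "(column_norm n (apply_matrix n X v))\<^sup>2 \<le> (\<Sum>i<n. (\<Sum>j<n. norm (X i j))\<^sup>2)"
    unfolding column_norm_sq
    by (rule sum_norm_le) (simp add: cstar_identity comp power_mono)
  then show "column_norm n (apply_matrix n X v) \<le> sqrt (\<Sum>i<n. (\<Sum>j<n. norm (X i j))\<^sup>2)"
    by (rule real_le_rsqrt)
qed

lemma column_norm_apply_matrix_le:
  assumes "column_norm n v \<le> 1"
  shows "column_norm n (apply_matrix n X v) \<le> matrix_norm n X"
proof -
  obtain K where "\<forall>v. column_norm n v \<le> 1 \<longrightarrow> column_norm n (apply_matrix n X v) \<le> K"
    using apply_matrix_bounded by blast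
  then show ?thesis
    unfolding matrix_norm_eq using assms
    by (intro cSup_upper) (auto simp: bdd_above_def)
qed

lemma matrix_norm_nonneg: "0 \<le> matrix_norm n X"
  by (rule order_trans[OF column_norm_nonneg column_norm_apply_matrix_le[of n "\<lambda>i. 0"]]) simp

lemma matrix_norm_le:
  assumes "\<And>v. column_norm n v \<le> 1 \<Longrightarrow> column_norm n (apply_matrix n X v) \<le> K"
  shows "matrix_norm n X \<le> K"
  unfolding matrix_norm_eq using assms
  by (intro cSup_least) (auto intro!: exI[of _ "\<lambda>i. 0"])

lemma column_norm_apply_matrix_le':
  "column_norm n (apply_matrix n X v) \<le> matrix_norm n X * column_norm n v"
proof (cases "column_norm n v = 0")
  case True
  then have "v j = 0" if "j < n" for j
    using norm_component_le_column_norm[OF that, of v] by simp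
  then have "apply_matrix n X v = (\<lambda>i. 0)" by (simp add: apply_matrix_def)
  then show ?thesis using True by simp
next
  case False
  define r where "r = column_norm n v"
  have r: "r > 0" using False column_norm_nonneg[of n v] unfolding r_def by linarith
  have "column_norm n (apply_matrix n X (\<lambda>i. (1/r) *\<^sub>R v i)) \<le> matrix_norm n X"
    using r by (intro column_norm_apply_matrix_le) (simp add: column_norm_scaleR r_def[symmetric])
  moreover have "apply_matrix n X (\<lambda>i. (1/r) *\<^sub>R v i) = (\<lambda>i. (1/r) *\<^sub>R apply_matrix n X v i)"
    by (simp add: apply_matrix_def scaleR_sum_right)
  ultimately show ?thesis
    using r by (simp add: column_norm_scaleR r_def[symmetric] field_simps)
qed

text \<open>Only the existence of some \<open>K\<close> matters: it makes the set in
  \<open>cb_norm\<close> bounded above. Stating the bound on columns lets sums be handled by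
  \<open>column_norm_add_le\<close>.\<close>

definition cb_bound :: "('a::cstar_algebra \<Rightarrow> 'a) \<Rightarrow> real \<Rightarrow> bool" where
  "cb_bound T K \<longleftrightarrow> (\<forall>n X v. column_norm n v \<le> 1 \<longrightarrow>
     column_norm n (apply_matrix n (amplification T X) v) \<le> K * matrix_norm n X)"

lemma cb_bound_of_completely_bounded:
  assumes "completely_bounded T" obtains K where "cb_bound T K"
  using assms column_norm_apply_matrix_le unfolding completely_bounded_def cb_bound_def
  by (meson order_trans)

lemma cb_bound_zero: "cb_bound (\<lambda>x. 0) 0"
  by (simp add: cb_bound_def apply_matrix_def amplification_def)

lemma cb_bound_add:
  fixes S T :: "'a::cstar_algebra \<Rightarrow> 'a"
  assumes "cb_bound S K" "cb_bound T L"
  shows "cb_bound (\<lambda>x. S x + T x) (2 * (K + L))"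
  unfolding cb_bound_def
proof (intro allI impI)
  fix n and X :: "nat \<Rightarrow> nat \<Rightarrow> 'a" and v :: "nat \<Rightarrow> 'a"
  assume v: "column_norm n v \<le> 1"
  have "apply_matrix n (amplification (\<lambda>x. S x + T x) X) v =
      (\<lambda>i. apply_matrix n (amplification S X) v i + apply_matrix n (amplification T X) v i)"
    by (simp add: apply_matrix_def amplification_def distrib_right sum.distrib)
  then have "column_norm n (apply_matrix n (amplification (\<lambda>x. S x + T x) X) v) \<le>
      2 * (column_norm n (apply_matrix n (amplification S X) v) + column_norm n (apply_matrix n (amplification T X) v))"
    using column_norm_add_le by simp
  also have "\<dots> \<le> 2 * (K * matrix_norm n X + L * matrix_norm n X)"
    using assms v unfolding cb_bound_def by (intro mult_left_mono add_mono) auto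
  finally show "column_norm n (apply_matrix n (amplification (\<lambda>x. S x + T x) X) v)
      \<le> 2 * (K + L) * matrix_norm n X" by (simp add: algebra_simps)
qed

lemma cb_bound_uminus:
  assumes "cb_bound T K" shows "cb_bound (\<lambda>x. - T x) K"
proof -
  have "apply_matrix n (amplification (\<lambda>x. - T x) X) v =
      (\<lambda>i. (- 1) *\<^sub>R apply_matrix n (amplification T X) v i)" for n X v
    by (simp add: apply_matrix_def amplification_def sum_negf)
  then show ?thesis
    using assms unfolding cb_bound_def by (simp only: column_norm_scaleR) simp
qed

text \<open>In the amplification \<open>a\<close> acts on the output column and \<open>b\<close> on
  the input column.\<close>

lemma cb_bound_mult:
  fixes a b :: "'a::cstar_algebra"
  shows "cb_bound (\<lambda>x. a * x * b) (norm a * norm b)"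
  unfolding cb_bound_def
proof (intro allI impI)
  fix n and X :: "nat \<Rightarrow> nat \<Rightarrow> 'a" and v :: "nat \<Rightarrow> 'a"
  assume v: "column_norm n v \<le> 1"
  have "apply_matrix n (amplification (\<lambda>x. a * x * b) X) v = (\<lambda>i. a * apply_matrix n X (\<lambda>j. b * v j) i)"
    by (simp add: apply_matrix_def amplification_def sum_distrib_left mult.assoc)
  then have "column_norm n (apply_matrix n (amplification (\<lambda>x. a * x * b) X) v)
      \<le> norm a * column_norm n (apply_matrix n X (\<lambda>j. b * v j))"
    by (simp add: column_norm_mult_le)
  also have "\<dots> \<le> norm a * (matrix_norm n X * (norm b * 1))"
    using v by (intro mult_left_mono order_trans[OF column_norm_apply_matrix_le']
        order_trans[OF column_norm_mult_le] matrix_norm_nonneg) auto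
  finally show "column_norm n (apply_matrix n (amplification (\<lambda>x. a * x * b) X) v)
      \<le> norm a * norm b * matrix_norm n X" by (simp add: mult_ac)
qed

lemma cb_bound_elementary: "\<exists>K. cb_bound (\<lambda>x. \<Sum>(a, b)\<leftarrow>l. a * x * b) K"
proof (induction l)
  case Nil
  then show ?case using cb_bound_zero by auto
next
  case (Cons p l)
  then obtain K where "cb_bound (\<lambda>x. \<Sum>(a, b)\<leftarrow>l. a * x * b) K" by blast
  then have "cb_bound (\<lambda>x. fst p * x * snd p + (\<Sum>(a, b)\<leftarrow>l. a * x * b)) (2 * (norm (fst p) * norm (snd p) + K))"
    by (rule cb_bound_add[OF cb_bound_mult])
  moreover have "(\<lambda>x. \<Sum>(a, b)\<leftarrow>p # l. a * x * b) = (\<lambda>x. fst p * x * snd p + (\<Sum>(a, b)\<leftarrow>l. a * x * b))"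
    by (simp add: split_beta)
  ultimately show ?case by metis
qed

text \<open>The operator norm is the \<open>1\<close> by \<open>1\<close> level of the cb-norm, and
  \<open>norm_le_of_mult_le\<close> recovers \<open>\<parallel>T x\<parallel>\<close> from that
  level. The assumed bound ensures that \<open>cb_norm T\<close> really is an upper bound.\<close>

lemma norm_le_cb_norm:
  fixes T :: "'a::cstar_algebra \<Rightarrow> 'a"
  assumes "cb_bound T K" and scale: "\<And>r x. T (r *\<^sub>R x) = r *\<^sub>R T x"
  shows "norm (T x) \<le> cb_norm T * norm x"
proof -
  have unit: "norm (T x) \<le> cb_norm T" if x: "norm x \<le> 1" for x
  proof -
    let ?X = "\<lambda>_ _. x"
    have col: "column_norm 1 v = norm (v 0)" for v :: "nat \<Rightarrow> 'a"
      by (simp add: column_norm_def cstar_identity)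
    have app: "apply_matrix 1 ?X v 0 = x * v 0" for v by (simp add: apply_matrix_def)
    have "matrix_norm 1 ?X \<le> 1"
    proof (rule matrix_norm_le)
      fix v :: "nat \<Rightarrow> 'a" assume "column_norm 1 v \<le> 1"
      then show "column_norm 1 (apply_matrix 1 ?X v) \<le> 1"
        using x norm_mult_ineq[of x "v 0"] mult_le_one[of "norm x" "norm (v 0)"]
        by (simp add: col app del: One_nat_def)
    qed
    moreover have "bdd_above {matrix_norm n (amplification T X) |n X. matrix_norm n X \<le> 1}"
    proof -
      have "matrix_norm n (amplification T X) \<le> \<bar>K\<bar>" if "matrix_norm n X \<le> 1" for n X
      proof (rule matrix_norm_le)
        fix v :: "nat \<Rightarrow> 'a" assume "column_norm n v \<le> 1"
        then have "column_norm n (apply_matrix n (amplification T X) v) \<le> K * matrix_norm n X"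
          using assms(1) by (simp add: cb_bound_def)
        also have "\<dots> \<le> \<bar>K\<bar> * 1"
          using that by (intro mult_mono) (auto simp: matrix_norm_nonneg)
        finally show "column_norm n (apply_matrix n (amplification T X) v) \<le> \<bar>K\<bar>" by simp
      qed
      then show ?thesis by (auto simp: bdd_above_def)
    qed
    ultimately have le: "matrix_norm 1 (amplification T ?X) \<le> cb_norm T"
      unfolding cb_norm_def by (intro cSup_upper) auto
    show ?thesis
    proof (rule norm_le_of_mult_le)
      show "0 \<le> cb_norm T" using le matrix_norm_nonneg order_trans by blast
      fix z
      have "apply_matrix 1 (amplification T ?X) (\<lambda>_. z) 0 = T x * z"
        by (simp add: apply_matrix_def amplification_def)
      then have "norm (T x * z) = column_norm 1 (apply_matrix 1 (amplification T ?X) (\<lambda>_. z))"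
        by (simp only: col)
      also have "\<dots> \<le> matrix_norm 1 (amplification T ?X) * norm z"
        using column_norm_apply_matrix_le'[of 1 "amplification T ?X" "\<lambda>_. z"] by (simp only: col)
      also have "\<dots> \<le> cb_norm T * norm z" by (intro mult_right_mono le) simp
      finally show "norm (T x * z) \<le> cb_norm T * norm z" .
    qed
  qed
  show ?thesis
  proof (cases "x = 0")
    case True
    then show ?thesis using scale[of 0 x] by simp
  next
    case False
    then have "norm (T ((1 / norm x) *\<^sub>R x)) \<le> cb_norm T" by (intro unit) simp
    then show ?thesis using False by (simp add: scale field_simps)
  qed
qed

section \<open>Derivations in the image of the canonical contraction\<close>

text \<open>A list is chosen for each tensor of an approximating sequence, and
  \<open>\<epsilon> n\<close> is the cb-norm of the \<open>n\<close>-th error.\<close>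

lemma Im_theta_elementary_approx:
  fixes T :: "'a::cstar_algebra \<Rightarrow> 'a"
  assumes "T \<in> Im_theta"
  shows "\<exists>l \<epsilon>. \<epsilon> \<longlonglongrightarrow> 0 \<and> (\<forall>n x. norm ((\<Sum>(a, b)\<leftarrow>l n. a * x * b) - T x) \<le> \<epsilon> n * norm x)"
proof -
  obtain s where T: "T \<in> ICB" and lim: "(\<lambda>n. cb_norm (\<lambda>x. theta_alg (s n) x - T x)) \<longlonglongrightarrow> 0"
    using assms by (auto simp: Im_theta_def theta_graph_def)
  have "\<exists>l. theta_alg t = (\<lambda>x. \<Sum>(a, b)\<leftarrow>l. a * x * b)" for t :: "'a tensor"
    by (induction t rule: tensor.abs_induct) (auto simp: theta_alg.abs_eq)
  then have "\<forall>n. \<exists>l. theta_alg (s n) = (\<lambda>x. \<Sum>(a, b)\<leftarrow>l. a * x * b)" by blast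
  from choice[OF this] obtain l where l: "\<forall>n. theta_alg (s n) = (\<lambda>x. \<Sum>(a, b)\<leftarrow>l n. a * x * b)" ..
  have T_lin: "T (r *\<^sub>R x) = r *\<^sub>R T x" for r x
    using T by (simp add: ICB_def completely_bounded_def complex_linear_def scaleR_scaleC)
  have l_lin: "(\<Sum>(a, b)\<leftarrow>k. a * (r *\<^sub>R x) * b) = r *\<^sub>R (\<Sum>(a, b)\<leftarrow>k. a * x * b)" for k r and x :: 'a
    by (induction k) (auto simp: scaleR_right_distrib)
  have "completely_bounded T" using T by (simp add: ICB_def)
  then obtain L where "cb_bound T L" by (rule cb_bound_of_completely_bounded)
  then have L: "cb_bound (\<lambda>x. - T x) L" by (rule cb_bound_uminus)
  show ?thesis
  proof (intro exI conjI allI, rule lim)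
    fix n x
    obtain K where "cb_bound (\<lambda>x. \<Sum>(a, b)\<leftarrow>l n. a * x * b) K" using cb_bound_elementary[of "l n"] ..
    from cb_bound_add[OF this L] have "cb_bound (\<lambda>x. theta_alg (s n) x - T x) (2 * (K + L))"
      by (simp add: l)
    moreover have "theta_alg (s n) (r *\<^sub>R x) - T (r *\<^sub>R x) = r *\<^sub>R (theta_alg (s n) x - T x)" for r x
      by (simp only: l[rule_format] T_lin l_lin scaleR_diff_right)
    ultimately have "norm (theta_alg (s n) x - T x) \<le> cb_norm (\<lambda>x. theta_alg (s n) x - T x) * norm x"
      by (rule norm_le_cb_norm)
    then show "norm ((\<Sum>(a, b)\<leftarrow>l n. a * x * b) - T x) \<le>
        cb_norm (\<lambda>x. theta_alg (s n) x - T x) * norm x"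
      by (simp only: l[rule_format])
  qed
qed

lemma haagerup_norm_zero: "haagerup_norm (0 :: 'a::cstar_algebra tensor) = 0"
  unfolding haagerup_norm_def
proof (rule cInf_eq_minimum)
  show "0 \<in> {sqrt (norm (\<Sum>(a, b)\<leftarrow>l. a * adj a)) * sqrt (norm (\<Sum>(a, b)\<leftarrow>l. adj b * b)) | l.
      tensor_of l = (0 :: 'a tensor)}"
    by (auto simp: zero_tensor_def intro!: exI[of _ "[]"])
qed auto

text \<open>Supplies the inclusion of the zero map in the nonunital claim, through the class of the
  constant zero sequence.\<close>

lemma zero_in_Im_theta: "(\<lambda>x. 0 :: 'a::cstar_algebra) \<in> Im_theta"
proof -
  define s where "s = (\<lambda>n::nat. 0 :: 'a tensor)"
  have "haagerup_Cauchy s" by (simp add: haagerup_Cauchy_def s_def haagerup_norm_zero)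
  then have s: "s \<in> haagerup_null_rel `` {s}" "haagerup_null_rel `` {s} \<in> haagerup_tensor_product"
    by (auto simp: haagerup_null_rel_def haagerup_tensor_product_def quotient_def s_def haagerup_norm_zero)
  have zero: "matrix_norm n (amplification (\<lambda>x. 0) X) = 0" for n and X :: "nat \<Rightarrow> nat \<Rightarrow> 'a"
    by (rule antisym[OF matrix_norm_le matrix_norm_nonneg])
       (simp add: apply_matrix_def amplification_def)
  have "completely_bounded (\<lambda>x. 0 :: 'a)"
    by (auto simp: completely_bounded_def complex_linear_def zero intro!: exI[of _ 0])
  then have ICB: "(\<lambda>x. 0 :: 'a) \<in> ICB"
    by (auto simp: ICB_def cstar_ideal_def)
  have "matrix_norm n (\<lambda>i j. 0 :: 'a) = 0" for n
    using zero[of n "\<lambda>i j. 0"] by (simp add: amplification_def)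
  then have "{matrix_norm n (amplification (\<lambda>x. 0) X) |n (X :: nat \<Rightarrow> nat \<Rightarrow> 'a). matrix_norm n X \<le> 1} = {0}"
    unfolding zero by (auto intro!: exI[of _ "\<lambda>i j. 0"])
  then have "cb_norm (\<lambda>x. 0 :: 'a) = 0" by (simp add: cb_norm_def)
  moreover have "theta_alg (s n) = (\<lambda>x. 0)" for n
    unfolding s_def zero_tensor_def by (simp add: theta_alg.abs_eq)
  ultimately have "theta_graph (haagerup_null_rel `` {s}) (\<lambda>x. 0)"
    unfolding theta_graph_def using s ICB by (auto intro!: bexI[of _ s])
  then show ?thesis by (auto simp: Im_theta_def)
qed

theorem theorem4p3:
  assumes "prime_cstar_ideal ({0} :: 'a::cstar_algebra set)"
  shows "(\<forall>\<delta> \<in> Der \<inter> Im_theta. \<exists>a::'a. \<forall>x. \<delta> x = a * x - x * a) \<and>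
    ((\<nexists>e::'a. \<forall>x. e * x = x \<and> x * e = x) \<longrightarrow>
      (Der \<inter> Im_theta :: ('a \<Rightarrow> 'a) set) = {\<lambda>x. 0})"
proof (intro conjI ballI impI)
  fix \<delta> :: "'a \<Rightarrow> 'a"
  assume \<delta>: "\<delta> \<in> Der \<inter> Im_theta"
  have "\<exists>x::'a. x \<noteq> 0" using assms by (auto simp: prime_cstar_ideal_def)
  then obtain \<phi> :: "'a \<Rightarrow> complex" where \<phi>: "excising \<phi>" by (rule exists_excising)
  obtain l \<epsilon> where "\<epsilon> \<longlonglongrightarrow> 0" "\<forall>n x. norm ((\<Sum>(a, b)\<leftarrow>l n. a * x * b) - \<delta> x) \<le> \<epsilon> n * norm x"
    using Im_theta_elementary_approx \<delta> by blast
  then obtain b where "\<forall>y. \<delta> y = y * b - b * y"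
    using derivation_limit_of_elementary[OF assms \<phi>, of \<delta> l \<epsilon>] \<delta> by auto
  \<comment> \<open>The limit \<open>b\<close> implements \<open>\<delta>\<close> with the opposite
    sign convention, so the element sought is \<open>- b\<close>.\<close>
  then have "\<forall>x. \<delta> x = - b * x - x * - b" by simp
  then show "\<exists>a. \<forall>x. \<delta> x = a * x - x * a" by blast
next
  assume nonunital: "\<nexists>e::'a. \<forall>x. e * x = x \<and> x * e = x"
  have "\<delta> = (\<lambda>x. 0)" if \<delta>: "\<delta> \<in> Der \<inter> Im_theta" for \<delta> :: "'a \<Rightarrow> 'a"
  proof -
    obtain l \<epsilon> where "\<epsilon> \<longlonglongrightarrow> 0" "\<forall>n x. norm ((\<Sum>(a, b)\<leftarrow>l n. a * x * b) - \<delta> x) \<le> \<epsilon> n * norm x"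
      using Im_theta_elementary_approx \<delta> by blast
    then obtain b where b: "(\<lambda>n. \<Sum>(a, b)\<leftarrow>l n. 0 *\<^sub>C b) \<longlonglongrightarrow> b" "\<forall>y. \<delta> y = y * b - b * y"
      using derivation_limit_of_elementary[OF assms excising_zero[OF nonunital], of \<delta> l \<epsilon>] \<delta> by auto
    have "(\<Sum>(a, b)\<leftarrow>k. 0 *\<^sub>C b) = 0" for k :: "('a \<times> 'a) list" by (induction k) auto
    with b(1) have "b = 0" by (simp add: LIMSEQ_const_iff)
    with b(2) show ?thesis by auto
  qed
  moreover have "(\<lambda>x. 0 :: 'a) \<in> Der" by (simp add: Der_def complex_linear_def)
  ultimately show "(Der \<inter> Im_theta :: ('a \<Rightarrow> 'a) set) = {\<lambda>x. 0}" using zero_in_Im_theta by blast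
qed

end
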